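(* Let $\alpha\in(0,1)$, let $m\ge1$ and let $0\le r\le m$ be an integer. A symmetric integrable function $f:[0,1]^m\to\mathbb{C}$ satisfies $$\int_{A^{m-r}\times(\overline{A})^{r}} f = 0\quad\text{for every measurable }A\subseteq[0,1]\text{ with }\lambda(A)=\alpha$$ (where $\overline{A}=[0,1]\setminus A$) if and only if at least one of the following holds: (i) $f=0$ almost everywhere; (ii) setting $K:=K(m,r,\alpha):=\{k\in[m]:\ \sum_{i=0}^k\binom{m-r}{k-i}\binom{r}{i}\left(\frac{-\alpha}{1-\alpha}\right)^i=0\}$, we have $$f(x_1,\ldots,x_m)=\sum_{k\in K}\ \sum_{S\subseteq[m],\,|S|=k} g_k(x_S)$$ almost everywhere, where each $g_k:[0,1]^k\to\mathbb{C}$ is a symmetric integrable function satisfying $\int_0^1 g_k(x_1,\ldots,x_k)\,dx_i=0$ for every $i\in[k]$.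
   Context: $[m]=\{1,\ldots,m\}$, $\lambda$ is Lebesgue measure, $x_S$ denotes the restriction of $x\in[0,1]^m$ to the coordinates in $S$ (listed in increasing order). A function on $[0,1]^m$ is symmetric if it is invariant under all permutations of its coordinates. Binomial coefficients $\binom{a}{b}$ are $0$ when $b<0$ or $b>a$. *)

theory Defs
  imports "HOL-Analysis.Analysis"
begin

text \<open>Points of [0,1]^m are functions nat => real, extensional on the
coordinate set {..<m} (coordinates are 0-based: coordinate i here is
coordinate i+1 in the paper). The measure is (the completion of) the
product of Lebesgue measure on [0,1], i.e. Lebesgue measure on [0,1]^m.\<close>

definition cube :: "nat \<Rightarrow> (nat \<Rightarrow> real) measure" where
  "cube m = completion (PiM {..<m} (\<lambda>_. lebesgue_on {0..1::real}))"

definition symmetric_fun :: "nat \<Rightarrow> ((nat \<Rightarrow> real) \<Rightarrow> 'b) \<Rightarrow> bool" where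
  "symmetric_fun m f \<longleftrightarrow>
     (\<forall>\<sigma>. \<sigma> permutes {..<m} \<longrightarrow> (\<forall>x \<in> space (cube m). f (x \<circ> \<sigma>) = f x))"

definition subpt :: "nat set \<Rightarrow> (nat \<Rightarrow> real) \<Rightarrow> (nat \<Rightarrow> real)" where
  "subpt S x = (\<lambda>j\<in>{..<card S}. x (sorted_list_of_set S ! j))"

definition block :: "nat \<Rightarrow> nat \<Rightarrow> real set \<Rightarrow> (nat \<Rightarrow> real) set" where
  "block m r A = PiE {..<m} (\<lambda>i. if i < m - r then A else {0..1} - A)"

definition Kset :: "nat \<Rightarrow> nat \<Rightarrow> real \<Rightarrow> nat set" where
  "Kset m r \<alpha> = {k \<in> {1..m}.
     (\<Sum>i=0..k. real ((m - r) choose (k - i)) * real (r choose i) * (- \<alpha> / (1 - \<alpha>)) ^ i) = 0}"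

end

(* Write phi = 1_A - alpha. Since f is symmetric, expanding the product of the
factors alpha + phi(x_i) and 1 - alpha - phi(x_i) turns the integral of f over the block into
sum_k e_k tau_k(phi), where tau_k(phi) is the integral of f(x) phi(x_1)...phi(x_k) and e_k is a
nonzero multiple of the sum defining K. A component g_l(x_S) with vanishing marginals is orthogonal
to phi(x_1)...phi(x_k) unless S = {1..k}, which gives the "if" direction.

For "only if", indicators of sets of measure alpha are weak-* dense in the functions
v : [0,1] -> [0,1] of mean alpha, so the vanishing extends to v = alpha + t phi for every bounded
phi of mean zero and small t > 0. Comparing coefficients in t gives tau_k(phi) = 0 whenever
e_k is nonzero, and by polarisation f is orthogonal to all phi_1(x_1)...phi_k(x_k) with factors of
mean zero. Hence the k-th component of the Hoeffding decomposition of f vanishes for k not in K. *)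

theory Submission
  imports Defs "HOL-Probability.Infinite_Product_Measure"
begin

section \<open>Measure-preserving maps between cubes\<close>

text \<open>The obstacle is measurability. \<open>cube m\<close> is a completion, where sections of
  an integrable function are measurable only almost surely. Fubini, reindexing and the decomposition
  are therefore carried out on the uncompleted product \<open>P m\<close>, for an arbitrary
  probability measure \<open>L\<close> on the reals, and the result is transferred at the end. That
  transfer replaces f by a product-measurable function, which has to be made symmetric again at
  every point: only then does one function of k variables serve as the component of every S of size
  k. Weak limits do not commute with products in general. They do here because the factors of the
  weight sit in different coordinates: integrals over boxes factorise, and boxes determine the rest.
  The approximating sets need measure exactly \<alpha>, since nothing is assumed about any other
  set.\<close>

definition mix :: "nat \<Rightarrow> nat set \<Rightarrow> (nat \<Rightarrow> 'a) \<Rightarrow> (nat \<Rightarrow> 'a) \<Rightarrow> (nat \<Rightarrow> 'a)" where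
  "mix m I z y = (\<lambda>i\<in>{..<m}. if i \<in> I then z i else y i)"

locale prob_cube = prob_space L for L :: "real measure"
begin

abbreviation P :: "nat \<Rightarrow> (nat \<Rightarrow> real) measure" where
  "P m \<equiv> PiM {..<m} (\<lambda>_. L)"

sublocale product: product_prob_space "\<lambda>_::nat. L" UNIV
  by unfold_locales

lemma prob_space_P: "prob_space (P m)"
  by (intro prob_space_PiM prob_space_axioms)

sublocale P: prob_space "P m" for m
  by (rule prob_space_P)

lemma space_P: "space (P m) = {..<m} \<rightarrow>\<^sub>E space L"
  by (simp add: space_PiM)

lemma emeasure_P_box:
  "(\<And>i. i < m \<Longrightarrow> A i \<in> sets L) \<Longrightarrow> emeasure (P m) (PiE {..<m} A) = (\<Prod>i<m. emeasure L (A i))"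
  by (subst product.emeasure_PiM) auto

lemma measurable_update [measurable]:
  assumes "i < m" shows "(\<lambda>(x, t). x(i := t)) \<in> P m \<Otimes>\<^sub>M L \<rightarrow>\<^sub>M P m"
proof -
  have "insert i {..<m} = {..<m}" using assms by auto
  then show ?thesis using measurable_add_dim[of i "{..<m}" "\<lambda>_. L"] by simp
qed

text \<open>The old value of coordinate \<open>i\<close> is thrown away and an independent sample
  takes its place, so the law does not change. Transport along this map is Fubini in one coordinate,
  with no splitting of the index set.\<close>

lemma distr_update:
  assumes i: "i < m"
  shows "distr (P m \<Otimes>\<^sub>M L) (P m) (\<lambda>(x, t). x(i := t)) = P m"
proof (rule product.PiM_eqI)
  fix A assume A: "\<And>j. j \<in> {..<m} \<Longrightarrow> A j \<in> sets L"
  let ?B = "\<lambda>j. if j = i then space L else A j"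
  have eq: "(\<lambda>(x, t). x(i := t)) -` PiE {..<m} A \<inter> space (P m \<Otimes>\<^sub>M L) = PiE {..<m} ?B \<times> A i"
    using sets.sets_into_space[OF A] i
    by (fastforce simp: space_pair_measure space_P PiE_iff extensional_def fun_upd_def split: if_splits)
  have "emeasure (distr (P m \<Otimes>\<^sub>M L) (P m) (\<lambda>(x, t). x(i := t))) (PiE {..<m} A)
      = emeasure (P m \<Otimes>\<^sub>M L) (PiE {..<m} ?B \<times> A i)"
    using A i by (subst emeasure_distr) (auto simp: eq sets_PiM_I_finite)
  also have "\<dots> = emeasure (P m) (PiE {..<m} ?B) * emeasure L (A i)"
    using A i by (subst emeasure_pair_measure_Times) (auto intro!: sets_PiM_I_finite)
  also have "\<dots> = (\<Prod>j<m. emeasure L (?B j)) * emeasure L (A i)"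
    using A by (subst emeasure_P_box) auto
  also have "\<dots> = (\<Prod>j\<in>{..<m}. emeasure L (A j))"
    using i by (simp add: prod.remove[of "{..<m}" i] emeasure_space_1 mult.commute)
  finally show "emeasure (distr (P m \<Otimes>\<^sub>M L) (P m) (\<lambda>(x, t). x(i := t))) (PiE {..<m} A) = (\<Prod>j\<in>{..<m}. emeasure L (A j))" .
qed auto

lemma measurable_mix [measurable]:
  assumes "I \<subseteq> {..<k}"
  shows "(\<lambda>(z, y). mix m I z y) \<in> P k \<Otimes>\<^sub>M P m \<rightarrow>\<^sub>M P m"
  unfolding mix_def case_prod_beta
proof (rule measurable_restrict)
  fix i assume i: "i \<in> {..<m}"
  show "(\<lambda>x. if i \<in> I then fst x i else snd x i) \<in> P k \<Otimes>\<^sub>M P m \<rightarrow>\<^sub>M L"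
  proof (cases "i \<in> I")
    case True
    then have "i \<in> {..<k}" using assms by auto
    then show ?thesis using True by (auto intro!: measurable_compose[OF measurable_fst] measurable_component_singleton)
  next
    case False
    then show ?thesis using i by (auto intro!: measurable_compose[OF measurable_snd] measurable_component_singleton)
  qed
qed

text \<open>Every coordinate of the mixture is read from exactly one of two independent points, so
  the preimage of a box is a product of two boxes, filled up with \<open>space L\<close> in the
  coordinates not read. The first point may live on the smaller cube \<open>P k\<close>; this makes
  conditional means given \<open>k\<close> coordinates functions on \<open>P k\<close>.\<close>

lemma distr_mix:
  assumes I: "I \<subseteq> {..<k}" "k \<le> m"
  shows "distr (P k \<Otimes>\<^sub>M P m) (P m) (\<lambda>(z, y). mix m I z y) = P m"
proof (rule product.PiM_eqI)
  fix A assume A: "\<And>j. j \<in> {..<m} \<Longrightarrow> A j \<in> sets L"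
  let ?B = "\<lambda>j. if j \<in> I then A j else space L" and ?C = "\<lambda>j. if j \<in> I then space L else A j"
  have I': "I \<subseteq> {..<m}" using I by auto
  have eq: "(\<lambda>(z, y). mix m I z y) -` PiE {..<m} A \<inter> space (P k \<Otimes>\<^sub>M P m) = PiE {..<k} ?B \<times> PiE {..<m} ?C"
    using sets.sets_into_space[OF A] I I' unfolding mix_def
    apply (auto simp: space_pair_measure space_P PiE_iff split: if_splits)
    by (meson lessThan_iff subsetD)+
  have "emeasure (distr (P k \<Otimes>\<^sub>M P m) (P m) (\<lambda>(z, y). mix m I z y)) (PiE {..<m} A)
      = emeasure (P k \<Otimes>\<^sub>M P m) (PiE {..<k} ?B \<times> PiE {..<m} ?C)"
    using A I by (subst emeasure_distr) (auto simp: eq sets_PiM_I_finite)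
  also have "\<dots> = emeasure (P k) (PiE {..<k} ?B) * emeasure (P m) (PiE {..<m} ?C)"
    using A I by (subst P.emeasure_pair_measure_Times) (auto intro!: sets_PiM_I_finite)
  also have "\<dots> = (\<Prod>j<k. emeasure L (?B j)) * (\<Prod>j<m. emeasure L (?C j))"
    using A I by (subst (1 2) emeasure_P_box) auto
  also have "(\<Prod>j<k. emeasure L (?B j)) = (\<Prod>j<m. emeasure L (?B j))"
    using I by (intro prod.mono_neutral_left) (auto simp: emeasure_space_1)
  also have "\<dots> * (\<Prod>j<m. emeasure L (?C j)) = (\<Prod>j\<in>{..<m}. emeasure L (A j))"
    by (subst prod.distrib[symmetric], rule prod.cong) (auto simp: emeasure_space_1)
  finally show "emeasure (distr (P k \<Otimes>\<^sub>M P m) (P m) (\<lambda>(z, y). mix m I z y)) (PiE {..<m} A) = (\<Prod>j\<in>{..<m}. emeasure L (A j))" .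
qed auto

lemma measurable_reindex:
  assumes "\<pi> \<in> {..<k} \<rightarrow> {..<m}"
  shows "(\<lambda>x. \<lambda>j\<in>{..<k}. x (\<pi> j)) \<in> P m \<rightarrow>\<^sub>M P k"
  using assms by (intro measurable_restrict measurable_component_singleton) auto

lemma distr_reindex:
  assumes "inj_on \<pi> {..<k}" "\<pi> \<in> {..<k} \<rightarrow> {..<m}"
  shows "distr (P m) (P k) (\<lambda>x. \<lambda>j\<in>{..<k}. x (\<pi> j)) = P k"
  using distr_PiM_reindex[of "{..<m}" "\<lambda>_. L" \<pi> "{..<k}"] assms prob_space_axioms by simp

lemma integrable_update:
  fixes f :: "(nat \<Rightarrow> real) \<Rightarrow> 'b::{banach, second_countable_topology}"
  assumes i: "i < m" and f: "integrable (P m) f"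
  shows "integrable (P m \<Otimes>\<^sub>M L) (\<lambda>(x, t). f (x(i := t)))"
proof -
  have "integrable (distr (P m \<Otimes>\<^sub>M L) (P m) (\<lambda>(x, t). x(i := t))) f"
    using f i by (simp add: distr_update)
  from integrable_distr[OF measurable_update[OF i] this] show ?thesis
    by (simp add: case_prod_beta')
qed

lemma integral_update:
  fixes f :: "(nat \<Rightarrow> real) \<Rightarrow> 'b::{banach, second_countable_topology}"
  assumes i: "i < m" and f: "integrable (P m) f"
  shows "(LINT x|P m. f x) = (LINT x|P m. LINT t|L. f (x(i := t)))"
proof -
  interpret pair_sigma_finite "P m" L ..
  have "(LINT x|P m. f x) = (LINT x|distr (P m \<Otimes>\<^sub>M L) (P m) (\<lambda>(x, t). x(i := t)). f x)"
    using i by (simp add: distr_update)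
  also have "\<dots> = (LINT p|(P m \<Otimes>\<^sub>M L). (\<lambda>(x, t). f (x(i := t))) p)"
    using i f by (subst integral_distr) (auto simp: case_prod_beta')
  also have "\<dots> = (LINT x|P m. LINT t|L. f (x(i := t)))"
    using integral_fst[OF integrable_update[OF i f]] by simp
  finally show ?thesis .
qed

lemma integrable_mix:
  fixes f :: "(nat \<Rightarrow> real) \<Rightarrow> 'b::{banach, second_countable_topology}"
  assumes I: "I \<subseteq> {..<k}" "k \<le> m" and f: "integrable (P m) f"
  shows "integrable (P k \<Otimes>\<^sub>M P m) (\<lambda>(z, y). f (mix m I z y))"
proof -
  have "integrable (distr (P k \<Otimes>\<^sub>M P m) (P m) (\<lambda>(z, y). mix m I z y)) f"
    using f I by (simp add: distr_mix)
  from integrable_distr[OF measurable_mix[OF I(1)] this] show ?thesis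
    by (simp add: case_prod_beta')
qed

text \<open>The mechanism behind all orthogonality below: when coordinate \<open>i\<close> is
  resampled, \<open>W\<close> does not notice and leaves the inner integral, where \<open>h\<close>
  averages to zero.\<close>

lemma integral_vanish:
  fixes W h :: "(nat \<Rightarrow> real) \<Rightarrow> complex"
  assumes i: "i < m" and int: "integrable (P m) (\<lambda>x. W x * h x)"
    and W: "\<And>x t. x \<in> space (P m) \<Longrightarrow> t \<in> space L \<Longrightarrow> W (x(i := t)) = W x"
    and h: "AE x in P m. (LINT t|L. h (x(i := t))) = 0"
  shows "(LINT x|P m. W x * h x) = 0"
proof -
  have "(LINT x|P m. W x * h x) = (LINT x|P m. LINT t|L. W (x(i := t)) * h (x(i := t)))"
    by (rule integral_update[OF i int])
  also have "\<dots> = (LINT x|P m. W x * (LINT t|L. h (x(i := t))))"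
    by (intro Bochner_Integration.integral_cong refl) (simp add: W cong: Bochner_Integration.integral_cong)
  also have "\<dots> = 0"
    by (rule integral_eq_zero_AE) (use h in auto)
  finally show ?thesis .
qed

end

section \<open>The Hoeffding decomposition\<close>

lemma sum_Pow_minus_one:
  assumes "finite A"
  shows "(\<Sum>X\<in>Pow A. (-1) ^ card X) = (if A = {} then 1 else (0::complex))"
proof -
  have "(\<Sum>X\<in>Pow A. (-1) ^ card X) = (\<Prod>x\<in>A. (-1) + (1::complex))"
    using assms by (subst prod_add) auto
  then show ?thesis using assms by auto
qed

text \<open>After exchanging the sums, the coefficient of \<open>c J\<close> is the alternating sum
  over all subsets of \<open>U - J\<close>, which is zero unless \<open>J = U\<close>.\<close>

lemma sum_Pow_Moebius:
  fixes c :: "'b set \<Rightarrow> complex"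
  assumes U: "finite U"
  shows "(\<Sum>S\<in>Pow U. \<Sum>J\<in>Pow S. (-1) ^ (card S - card J) * c J) = c U"
proof -
  have "(\<Sum>S\<in>Pow U. \<Sum>J\<in>Pow S. (-1) ^ (card S - card J) * c J)
      = (\<Sum>S\<in>Pow U. \<Sum>J\<in>{J\<in>Pow U. J \<subseteq> S}. (-1) ^ (card S - card J) * c J)"
    by (intro sum.cong refl) auto
  also have "\<dots> = (\<Sum>J\<in>Pow U. \<Sum>S\<in>{S\<in>Pow U. J \<subseteq> S}. (-1) ^ (card S - card J) * c J)"
    using U by (intro sum.swap_restrict) auto
  also have "\<dots> = (\<Sum>J\<in>Pow U. if J = U then c J else 0)"
  proof (rule sum.cong[OF refl])
    fix J assume J: "J \<in> Pow U"
    then have fJ: "finite J" using U finite_subset by auto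
    have "(\<Sum>S\<in>{S\<in>Pow U. J \<subseteq> S}. (-1) ^ (card S - card J) * c J) = (\<Sum>T\<in>Pow (U - J). (-1) ^ card T * c J)"
    proof (rule sum.reindex_bij_witness[where i = "\<lambda>T. T \<union> J" and j = "\<lambda>S. S - J"])
      fix S assume "S \<in> {S\<in>Pow U. J \<subseteq> S}"
      then show "(-1) ^ card (S - J) * c J = (-1) ^ (card S - card J) * c J"
        using U fJ by (simp add: card_Diff_subset finite_subset)
    qed (use J in auto)
    also have "\<dots> = (if J = U then c J else 0)"
      using sum_Pow_minus_one[of "U - J"] U J by (auto simp flip: sum_distrib_right)
    finally show "(\<Sum>S\<in>{S\<in>Pow U. J \<subseteq> S}. (-1) ^ (card S - card J) * c J) = (if J = U then c J else 0)" .
  qed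
  also have "\<dots> = c U" using U by (subst sum.delta) auto
  finally show ?thesis .
qed

text \<open>Reduces an arbitrary \<open>S\<close> of size \<open>k\<close> to the first
  \<open>k\<close> coordinates. Symmetry of a function speaks of permutations of all
  \<open>m\<close> coordinates, so an enumeration of \<open>S\<close> has to be completed to
  one.\<close>

lemma ex_permutes_extension:
  fixes k m :: nat and p :: "nat \<Rightarrow> nat"
  assumes p: "bij_betw p {..<k} S" and S: "S \<subseteq> {..<m}"
  obtains \<pi> where "\<pi> permutes {..<m}" "\<And>j. j < k \<Longrightarrow> \<pi> j = p j" "\<pi> ` {..<k} = S"
proof -
  have fS: "finite S" by (rule finite_subset[OF S]) simp
  have k: "k = card S" using bij_betw_same_card[OF p] by simp
  have km: "k \<le> m" using card_mono[OF _ S] k by simp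
  have "card ({..<m} - {..<k}) = card ({..<m} - S)"
    using S k km fS by (simp add: card_Diff_subset)
  then obtain q where q: "bij_betw q ({..<m} - {..<k}) ({..<m} - S)"
    using finite_same_card_bij by (metis finite_Diff finite_lessThan)
  define \<pi> where "\<pi> j = (if j < k then p j else if j < m then q j else j)" for j
  have "bij_betw \<pi> {..<k} S" by (rule bij_betw_cong[THEN iffD1, OF _ p]) (simp add: \<pi>_def)
  moreover have "bij_betw \<pi> ({..<m} - {..<k}) ({..<m} - S)"
    by (rule bij_betw_cong[THEN iffD1, OF _ q]) (auto simp: \<pi>_def)
  ultimately have "bij_betw \<pi> ({..<k} \<union> ({..<m} - {..<k})) (S \<union> ({..<m} - S))"
    by (rule bij_betw_combine) auto
  then have "bij_betw \<pi> {..<m} {..<m}" using S km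
    by (metis Un_Diff_cancel Un_absorb1 lessThan_subset_iff)
  then have "\<pi> permutes {..<m}"
    by (rule bij_imp_permutes) (use km in \<open>auto simp: \<pi>_def\<close>)
  moreover have "\<pi> ` {..<k} = S" using \<open>bij_betw \<pi> {..<k} S\<close> by (simp add: bij_betw_def)
  ultimately show thesis using that by (auto simp: \<pi>_def)
qed

lemma bij_betw_sorted_list_of_set:
  "finite S \<Longrightarrow> bij_betw ((!) (sorted_list_of_set S)) {..<card S} (S :: nat set)"
  using bij_betw_nth[of "sorted_list_of_set S" "{..<card S}" S] by simp

context prob_cube
begin

text \<open>The integral runs over all \<open>m\<close> coordinates although those in
  \<open>I\<close> are overwritten. As \<open>P m\<close> has mass 1 this changes nothing, and the
  same measure serves for every \<open>I\<close>.\<close>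

definition cond_mean :: "nat \<Rightarrow> ((nat \<Rightarrow> real) \<Rightarrow> complex) \<Rightarrow> nat set \<Rightarrow> (nat \<Rightarrow> real) \<Rightarrow> complex" where
  "cond_mean m f I x = (LINT y|P m. f (mix m I x y))"

text \<open>Moebius inversion of the conditional means given \<open>x\<^sub>I\<close>. The component belonging to \<open>S\<close> is
  \<open>hoeffding m f (card S) (subpt S x)\<close>; only the coordinates of \<open>z\<close> below \<open>k\<close> matter.\<close>

definition hoeffding :: "nat \<Rightarrow> ((nat \<Rightarrow> real) \<Rightarrow> complex) \<Rightarrow> nat \<Rightarrow> (nat \<Rightarrow> real) \<Rightarrow> complex" where
  "hoeffding m f k z = (\<Sum>I\<in>Pow {..<k}. (-1) ^ (k - card I) * cond_mean m f I z)"

definition symmetric_on :: "nat \<Rightarrow> ((nat \<Rightarrow> real) \<Rightarrow> complex) \<Rightarrow> bool" where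
  "symmetric_on m f \<longleftrightarrow> (\<forall>\<sigma>. \<sigma> permutes {..<m} \<longrightarrow> (\<forall>x\<in>space (P m). f (x \<circ> \<sigma>) = f x))"

lemma integrable_cond_mean:
  assumes "I \<subseteq> {..<k}" "k \<le> m" "integrable (P m) f"
  shows "integrable (P k) (cond_mean m f I)"
proof -
  interpret pair_sigma_finite "P k" "P m" ..
  show ?thesis
    using integrable_fst[OF integrable_mix[OF assms]] by (simp add: cond_mean_def[abs_def])
qed

lemma integrable_hoeffding:
  assumes "k \<le> m" "integrable (P m) f"
  shows "integrable (P k) (hoeffding m f k)"
  unfolding hoeffding_def[abs_def]
  by (intro Bochner_Integration.integrable_sum integrable_mult_right integrable_cond_mean assms) auto

lemma cond_mean_update_notin:
  "i \<notin> I \<Longrightarrow> cond_mean m f I (z(i := t)) = cond_mean m f I z"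
proof -
  assume "i \<notin> I"
  then have "mix m I (z(i := t)) y = mix m I z y" for y
    by (auto simp: mix_def fun_eq_iff)
  then show ?thesis by (simp add: cond_mean_def)
qed

text \<open>The tower property. Putting \<open>t\<close> into coordinate \<open>i\<close> of
  \<open>z\<close> while \<open>i\<close> is read from \<open>z\<close> has the same effect as
  putting it into \<open>y\<close> while \<open>i\<close> is read from \<open>y\<close>, so the
  integral over \<open>t\<close> merely resamples \<open>y\<close>. The null set comes from the
  sections of \<open>f\<close> that are not integrable.\<close>

lemma integral_cond_mean_update:
  assumes I: "I \<subseteq> {..<k}" "k \<le> m" "i \<in> I" and f: "integrable (P m) f"
  shows "AE z in P k. integrable L (\<lambda>t. cond_mean m f I (z(i := t))) \<and>
     (LINT t|L. cond_mean m f I (z(i := t))) = cond_mean m f (I - {i}) z"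
proof -
  interpret km: pair_sigma_finite "P k" "P m" ..
  interpret mL: pair_sigma_finite "P m" L ..
  have im: "i < m" using I by auto
  have "AE z in P k. integrable (P m) (\<lambda>y. f (mix m (I - {i}) z y))"
    using km.AE_integrable_fst[OF integrable_mix[of "I - {i}" k m f]] I f by auto
  then show ?thesis
  proof eventually_elim
    case (elim z)
    have eq: "mix m (I - {i}) z (y(i := t)) = mix m I (z(i := t)) y" for y t
      using im I(3) by (auto simp: mix_def fun_eq_iff)
    have int: "integrable (P m \<Otimes>\<^sub>M L) (\<lambda>(y, t). f (mix m I (z(i := t)) y))"
      using integrable_update[OF im elim] by (simp add: eq)
    have "cond_mean m f (I - {i}) z = (LINT y|P m. LINT t|L. f (mix m I (z(i := t)) y))"
      unfolding cond_mean_def using integral_update[OF im elim] by (simp add: eq)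
    also have "\<dots> = (LINT t|L. LINT y|P m. f (mix m I (z(i := t)) y))"
      using mL.Fubini_integral[OF int] by simp
    finally show ?case using mL.integrable_snd[OF int] by (simp add: cond_mean_def)
  qed
qed

text \<open>\<open>J\<close> and \<open>insert i J\<close> carry opposite signs, and averaging over
  coordinate \<open>i\<close> turns the conditional mean given \<open>insert i J\<close> into the
  one given \<open>J\<close>. The terms cancel in pairs.\<close>

lemma hoeffding_marginal:
  assumes k: "k \<le> m" "i < k" and f: "integrable (P m) f"
  shows "AE z in P k. (LINT t|L. hoeffding m f k (z(i := t))) = 0"
proof -
  define A where "A = {..<k} - {i}"
  have A: "{..<k} = insert i A" "i \<notin> A" "finite A" using k by (auto simp: A_def)
  have split: "hoeffding m f k z = (\<Sum>J\<in>Pow A. (-1) ^ (k - card J) * (cond_mean m f J z - cond_mean m f (insert i J) z))" for z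
  proof -
    have "hoeffding m f k z = (\<Sum>I\<in>Pow A. (-1) ^ (k - card I) * cond_mean m f I z)
        + (\<Sum>I\<in>insert i ` Pow A. (-1) ^ (k - card I) * cond_mean m f I z)"
      unfolding hoeffding_def A(1) Pow_insert using A by (intro sum.union_disjoint) auto
    also have "(\<Sum>I\<in>insert i ` Pow A. (-1) ^ (k - card I) * cond_mean m f I z)
       = (\<Sum>J\<in>Pow A. (-1) ^ (k - card (insert i J)) * cond_mean m f (insert i J) z)"
      using A by (subst sum.reindex) (auto simp: inj_on_def)
    also have "\<dots> = (\<Sum>J\<in>Pow A. - ((-1) ^ (k - card J) * cond_mean m f (insert i J) z))"
    proof (intro sum.cong refl)
      fix J assume J: "J \<in> Pow A"
      then have "finite J" "i \<notin> J" using A finite_subset by auto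
      moreover have "card J \<le> card A" using J A by (auto intro: card_mono)
      moreover have "card A = k - 1" using k by (simp add: A_def)
      ultimately have "k - card J = Suc (k - card (insert i J))" using k by simp
      then show "(-1) ^ (k - card (insert i J)) * cond_mean m f (insert i J) z = - ((-1) ^ (k - card J) * cond_mean m f (insert i J) z)"
        by simp
    qed
    finally show ?thesis by (simp add: sum.distrib[symmetric] algebra_simps)
  qed
  have "AE z in P k. \<forall>J\<in>Pow A. integrable L (\<lambda>t. cond_mean m f (insert i J) (z(i := t))) \<and>
     (LINT t|L. cond_mean m f (insert i J) (z(i := t))) = cond_mean m f J z"
  proof (rule AE_finite_allI)
    fix J assume J: "J \<in> Pow A"
    then have "insert i J - {i} = J" "insert i J \<subseteq> {..<k}" using A by auto
    then show "AE z in P k. integrable L (\<lambda>t. cond_mean m f (insert i J) (z(i := t))) \<and>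
     (LINT t|L. cond_mean m f (insert i J) (z(i := t))) = cond_mean m f J z"
      using integral_cond_mean_update[of "insert i J" k m i f] k f by auto
  qed (use A in auto)
  then show ?thesis
  proof eventually_elim
    case (elim z)
    have c: "cond_mean m f J (z(i := t)) = cond_mean m f J z" if "J \<in> Pow A" for J t
      using that A by (intro cond_mean_update_notin) auto
    have "(LINT t|L. hoeffding m f k (z(i := t)))
       = (\<Sum>J\<in>Pow A. LINT t|L. (-1) ^ (k - card J) * (cond_mean m f J z - cond_mean m f (insert i J) (z(i := t))))"
      unfolding split using elim
      by (subst Bochner_Integration.integral_sum[symmetric]) (auto simp: c intro!: sum.cong Bochner_Integration.integral_cong)
    also have "\<dots> = 0"
      using elim by (intro sum.neutral) (auto simp: prob_space)
    finally show ?case .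
  qed
qed

section \<open>Conditional means and components under permutations of the coordinates\<close>

lemma measurable_mix_right:
  assumes "\<And>i. i \<in> I \<Longrightarrow> i < m \<Longrightarrow> z i \<in> space L"
  shows "mix m I z \<in> P m \<rightarrow>\<^sub>M P m"
  unfolding mix_def
proof (rule measurable_restrict)
  fix i assume "i \<in> {..<m}"
  then show "(\<lambda>y. if i \<in> I then z i else y i) \<in> P m \<rightarrow>\<^sub>M L"
    using assms[of i] by (cases "i \<in> I") (auto intro!: measurable_const measurable_component_singleton)
qed

text \<open>Agreement of \<open>z\<close> with the permuted \<open>x\<close> is asked on
  \<open>I\<close> only, so that \<open>z\<close> may be a point of a smaller cube, such as
  \<open>subpt S x\<close>. Permuting the integrated point preserves the measure; what remains is a
  permutation of the whole argument of \<open>f\<close>.\<close>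

lemma cond_mean_permute:
  assumes \<pi>: "\<pi> permutes {..<m}" and I: "I \<subseteq> {..<m}"
    and z: "\<And>i. i \<in> I \<Longrightarrow> z i = x (\<pi> i)" and x: "\<And>i. i \<in> \<pi> ` I \<Longrightarrow> x i \<in> space L"
    and f: "integrable (P m) f" "symmetric_on m f"
  shows "cond_mean m f I z = cond_mean m f (\<pi> ` I) x"
proof -
  let ?r = "\<lambda>y. \<lambda>j\<in>{..<m}. y (\<pi> j)"
  have \<pi>': "\<pi> i < m \<longleftrightarrow> i < m" for i using permutes_in_image[OF \<pi>, of i] by simp
  have mz: "mix m I z \<in> P m \<rightarrow>\<^sub>M P m" by (rule measurable_mix_right) (simp add: z x)
  have r: "?r \<in> P m \<rightarrow>\<^sub>M P m" by (rule measurable_reindex) (auto simp: \<pi>')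
  have "cond_mean m f I z = (LINT y|distr (P m) (P m) ?r. f (mix m I z y))"
    unfolding cond_mean_def using permutes_inj_on[OF \<pi>] \<pi>' by (subst distr_reindex) auto
  also have "\<dots> = (LINT y|P m. f (mix m I z (?r y)))"
    using r measurable_compose[OF mz, of f] f by (intro integral_distr) auto
  also have "\<dots> = (LINT y|P m. f (mix m (\<pi> ` I) x y))"
  proof (rule Bochner_Integration.integral_cong[OF refl])
    fix y assume y: "y \<in> space (P m)"
    have "mix m I z (?r y) = mix m (\<pi> ` I) x y \<circ> \<pi>"
      using \<pi>' z permutes_inj[OF \<pi>] by (auto simp: mix_def fun_eq_iff inj_image_mem_iff)
    moreover have "mix m (\<pi> ` I) x y \<in> space (P m)"
      using measurable_space[OF measurable_mix_right y] x by auto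
    ultimately show "f (mix m I z (?r y)) = f (mix m (\<pi> ` I) x y)"
      using f(2) \<pi> by (simp add: symmetric_on_def)
  qed
  finally show ?thesis by (simp add: cond_mean_def)
qed

lemma hoeffding_symmetric:
  assumes "k \<le> m" and f: "integrable (P m) f" "symmetric_on m f"
  shows "symmetric_on k (hoeffding m f k)"
  unfolding symmetric_on_def
proof (intro allI impI ballI)
  fix \<sigma> z assume \<sigma>: "\<sigma> permutes {..<k}" and z: "z \<in> space (P k)"
  have \<sigma>m: "\<sigma> permutes {..<m}" by (rule permutes_subset[OF \<sigma>]) (use assms in auto)
  have "hoeffding m f k (z \<circ> \<sigma>) = (\<Sum>I\<in>Pow {..<k}. (-1) ^ (k - card (\<sigma> ` I)) * cond_mean m f (\<sigma> ` I) z)"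
    unfolding hoeffding_def
  proof (intro sum.cong refl arg_cong2[where f = "(*)"])
    fix I assume I: "I \<in> Pow {..<k}"
    show "cond_mean m f I (z \<circ> \<sigma>) = cond_mean m f (\<sigma> ` I) z"
      using z I permutes_in_image[OF \<sigma>] assms(1)
      by (intro cond_mean_permute \<sigma>m f) (auto simp: space_P PiE_iff)
    show "(-1) ^ (k - card I) = ((-1) ^ (k - card (\<sigma> ` I)) :: complex)"
      by (simp add: card_image permutes_inj_on[OF \<sigma>])
  qed
  also have "\<dots> = (\<Sum>J\<in>(`) \<sigma> ` Pow {..<k}. (-1) ^ (k - card J) * cond_mean m f J z)"
    using inj_on_image_Pow[OF permutes_inj_on[OF \<sigma>]] by (subst sum.reindex) auto
  also have "(`) \<sigma> ` Pow {..<k} = Pow {..<k}"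
    by (simp add: image_Pow_surj permutes_image[OF \<sigma>])
  finally show "hoeffding m f k (z \<circ> \<sigma>) = hoeffding m f k z" by (simp add: hoeffding_def comp_def)
qed

text \<open>The reason why one function of \<open>k\<close> variables serves all \<open>S\<close> of
  size \<open>k\<close>: the increasing enumeration of \<open>S\<close> extends to a permutation of
  all coordinates, which carries the subsets of \<open>{..<k}\<close> to those of \<open>S\<close>
  and keeps their sizes.\<close>

lemma hoeffding_subpt:
  assumes S: "S \<subseteq> {..<m}" and x: "x \<in> space (P m)" and f: "integrable (P m) f" "symmetric_on m f"
  shows "hoeffding m f (card S) (subpt S x) = (\<Sum>J\<in>Pow S. (-1) ^ (card S - card J) * cond_mean m f J x)"
proof -
  let ?k = "card S"
  have fS: "finite S" by (rule finite_subset[OF S]) simp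
  obtain \<pi> where \<pi>: "\<pi> permutes {..<m}" "\<And>j. j < ?k \<Longrightarrow> \<pi> j = sorted_list_of_set S ! j" "\<pi> ` {..<?k} = S"
    using ex_permutes_extension[OF bij_betw_sorted_list_of_set[OF fS] S] by metis
  have km: "?k \<le> m" using card_mono[OF _ S] by simp
  have "hoeffding m f ?k (subpt S x) = (\<Sum>I\<in>Pow {..<?k}. (-1) ^ (?k - card (\<pi> ` I)) * cond_mean m f (\<pi> ` I) x)"
    unfolding hoeffding_def
  proof (intro sum.cong refl arg_cong2[where f = "(*)"])
    fix I assume I: "I \<in> Pow {..<?k}"
    have \<pi>I: "\<pi> ` I \<subseteq> S" using \<pi>(3) I by auto
    have "x i \<in> space L" if "i \<in> \<pi> ` I" for i
      using that \<pi>I S x by (auto simp: space_P)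
    then show "cond_mean m f I (subpt S x) = cond_mean m f (\<pi> ` I) x"
      using I km \<pi>(2) by (intro cond_mean_permute \<pi>(1) f) (auto simp: subpt_def)
    show "(-1) ^ (?k - card I) = ((-1) ^ (?k - card (\<pi> ` I)) :: complex)"
      by (simp add: card_image permutes_inj_on[OF \<pi>(1)])
  qed
  also have "\<dots> = (\<Sum>J\<in>(`) \<pi> ` Pow {..<?k}. (-1) ^ (?k - card J) * cond_mean m f J x)"
    using inj_on_image_Pow[OF permutes_inj_on[OF \<pi>(1)]] by (subst sum.reindex) auto
  also have "(`) \<pi> ` Pow {..<?k} = Pow S"
    by (simp add: image_Pow_surj \<pi>(3))
  finally show ?thesis .
qed

text \<open>Inversion leaves the conditional mean given all coordinates, where nothing remains to be
  integrated. The identity therefore holds at every point, without a null set.\<close>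

lemma hoeffding_decomposition:
  assumes x: "x \<in> space (P m)" and f: "integrable (P m) f" "symmetric_on m f"
  shows "f x = (\<Sum>S\<in>Pow {..<m}. hoeffding m f (card S) (subpt S x))"
proof -
  have "(\<Sum>S\<in>Pow {..<m}. hoeffding m f (card S) (subpt S x))
      = (\<Sum>S\<in>Pow {..<m}. \<Sum>J\<in>Pow S. (-1) ^ (card S - card J) * cond_mean m f J x)"
    using x f by (intro sum.cong refl hoeffding_subpt) auto
  also have "\<dots> = cond_mean m f {..<m} x" by (rule sum_Pow_Moebius) simp
  also have "\<dots> = f x"
  proof -
    have "mix m {..<m} x y = x" for y
      using x by (auto simp: mix_def space_P PiE_iff extensional_def fun_eq_iff)
    then show ?thesis by (simp add: cond_mean_def P.prob_space)
  qed
  finally show ?thesis by simp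
qed

end

section \<open>Expansion of block integrals\<close>

text \<open>The coefficient of \<open>T ^ k\<close> in
  \<open>(1 + T) ^ (m - r) * (1 - \<alpha> / (1 - \<alpha>) * T) ^ r\<close>.\<close>

definition block_coeff :: "nat \<Rightarrow> nat \<Rightarrow> real \<Rightarrow> nat \<Rightarrow> real" where
  "block_coeff m r \<alpha> k = (\<Sum>i=0..k. real ((m - r) choose (k - i)) * real (r choose i) * (- \<alpha> / (1 - \<alpha>)) ^ i)"

lemma card_subsets_split:
  assumes A: "finite A" "finite B" "A \<inter> B = {}" and i: "i \<le> k"
  shows "card {S \<in> Pow (A \<union> B). card S = k \<and> card (S \<inter> B) = i} = (card A choose (k - i)) * (card B choose i)"
proof -
  let ?X = "{X. X \<subseteq> A \<and> card X = k - i}" and ?Y = "{Y. Y \<subseteq> B \<and> card Y = i}"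
  have "bij_betw (\<lambda>(X, Y). X \<union> Y) (?X \<times> ?Y) {S \<in> Pow (A \<union> B). card S = k \<and> card (S \<inter> B) = i}"
  proof (rule bij_betw_byWitness[where f' = "\<lambda>S. (S \<inter> A, S \<inter> B)"])
    show "(\<lambda>(X, Y). X \<union> Y) ` (?X \<times> ?Y) \<subseteq> {S \<in> Pow (A \<union> B). card S = k \<and> card (S \<inter> B) = i}"
    proof clarsimp
      fix X Y assume XY: "X \<subseteq> A" "card X = k - card Y" "Y \<subseteq> B" "i = card Y"
      have "card (X \<union> Y) = card X + card Y"
        using XY A by (intro card_Un_disjoint) (auto intro: finite_subset)
      moreover have "(X \<union> Y) \<inter> B = Y" using XY A by auto
      ultimately show "X \<subseteq> A \<union> B \<and> Y \<subseteq> A \<union> B \<and> card (X \<union> Y) = k \<and> card ((X \<union> Y) \<inter> B) = card Y"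
        using XY i by auto
    qed
    show "(\<lambda>S. (S \<inter> A, S \<inter> B)) ` {S \<in> Pow (A \<union> B). card S = k \<and> card (S \<inter> B) = i} \<subseteq> ?X \<times> ?Y"
    proof clarsimp
      fix S assume S: "S \<subseteq> A \<union> B"
      have "card ((S \<inter> A) \<union> (S \<inter> B)) = card (S \<inter> A) + card (S \<inter> B)"
        using A by (intro card_Un_disjoint) auto
      moreover have "(S \<inter> A) \<union> (S \<inter> B) = S" using S by auto
      ultimately show "card (S \<inter> A) = card S - card (S \<inter> B)" by simp
    qed
  qed (use A in auto)
  then have "card {S \<in> Pow (A \<union> B). card S = k \<and> card (S \<inter> B) = i} = card (?X \<times> ?Y)"
    by (rule bij_betw_same_card[symmetric])
  then show ?thesis using A by (simp add: card_cartesian_product n_subsets)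
qed

text \<open>The left side is the elementary symmetric polynomial of degree \<open>k\<close> in
  \<open>m - r\<close> ones and \<open>r\<close> copies of \<open>\<beta>\<close>. The weight of a
  set depends only on how many of its elements lie among the last \<open>r\<close>
  coordinates.\<close>

lemma sum_subsets_weight:
  fixes m r k :: nat and \<beta> :: real
  assumes r: "r \<le> m"
  shows "(\<Sum>S\<in>{S \<in> Pow {..<m}. card S = k}. \<Prod>i\<in>S. if i < m - r then 1 else \<beta>)
    = (\<Sum>i=0..k. real ((m - r) choose (k - i)) * real (r choose i) * \<beta> ^ i)"
proof -
  let ?A = "{..<m - r}" and ?B = "{m - r..<m}"
  have U: "{..<m} = ?A \<union> ?B" using r by auto
  let ?F = "{S \<in> Pow {..<m}. card S = k}"
  have "(\<Sum>S\<in>?F. \<Prod>i\<in>S. if i < m - r then 1 else \<beta>) = (\<Sum>S\<in>?F. \<beta> ^ card (S \<inter> ?B))"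
  proof (intro sum.cong refl)
    fix S assume S: "S \<in> ?F"
    then have fS: "finite S" by (auto intro: finite_subset)
    have "(\<Prod>i\<in>S. if i < m - r then 1 else \<beta>) = (\<Prod>i\<in>S \<inter> ?B. \<beta>)"
      using S fS by (intro prod.mono_neutral_cong_right) auto
    then show "(\<Prod>i\<in>S. if i < m - r then 1 else \<beta>) = \<beta> ^ card (S \<inter> ?B)" by simp
  qed
  also have "\<dots> = (\<Sum>i\<in>{0..k}. \<Sum>S\<in>{S \<in> ?F. card (S \<inter> ?B) = i}. \<beta> ^ card (S \<inter> ?B))"
  proof (intro sum.group[symmetric])
    show "(\<lambda>S. card (S \<inter> ?B)) ` ?F \<subseteq> {0..k}"
      by (auto intro!: card_mono intro: finite_subset[of _ "{..<m}"])
  qed auto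
  also have "\<dots> = (\<Sum>i\<in>{0..k}. real (card {S \<in> Pow (?A \<union> ?B). card S = k \<and> card (S \<inter> ?B) = i}) * \<beta> ^ i)"
    by (intro sum.cong refl) (simp add: U conj_assoc)
  also have "\<dots> = (\<Sum>i=0..k. real ((m - r) choose (k - i)) * real (r choose i) * \<beta> ^ i)"
    using r by (intro sum.cong refl) (subst card_subsets_split; auto)
  finally show ?thesis .
qed

text \<open>Origin of the ratio in \<open>Kset\<close>. Relative to the product of all constant
  terms, an index in \<open>S\<close> contributes slope over constant term:
  \<open>1 / \<alpha>\<close> for the first \<open>m - r\<close> coordinates and
  \<open>-1 / (1 - \<alpha>)\<close> for the others. Taking \<open>1 / \<alpha>\<close> out of each
  of the \<open>k\<close> factors leaves \<open>1\<close> and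
  \<open>- \<alpha> / (1 - \<alpha>)\<close>.\<close>

lemma sum_block_weights:
  assumes \<alpha>: "0 < \<alpha>" "\<alpha> < 1" and r: "r \<le> m"
  shows "(\<Sum>S\<in>{S \<in> Pow {..<m}. card S = k}.
      (\<Prod>i\<in>S. if i < m - r then 1 else -1) * (\<Prod>i\<in>{..<m} - S. if i < m - r then \<alpha> else 1 - \<alpha>))
    = \<alpha> ^ (m - r) * (1 - \<alpha>) ^ r / \<alpha> ^ k * block_coeff m r \<alpha> k"
proof -
  let ?p = "\<lambda>i. if i < m - r then \<alpha> else 1 - \<alpha>" and ?q = "\<lambda>i. if i < m - r then 1 else -1 :: real"
  let ?\<rho> = "\<lambda>i. if i < m - r then 1 else - \<alpha> / (1 - \<alpha>)"
  have p: "prod ?p {..<m} = \<alpha> ^ (m - r) * (1 - \<alpha>) ^ r"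
  proof -
    have U: "{..<m} = {..<m - r} \<union> {m - r..<m}" using r by auto
    have "prod ?p {..<m} = prod ?p {..<m - r} * prod ?p {m - r..<m}"
      unfolding U by (rule prod.union_disjoint) auto
    then show ?thesis using r by simp
  qed
  have "prod ?q S * prod ?p ({..<m} - S) = \<alpha> ^ (m - r) * (1 - \<alpha>) ^ r / \<alpha> ^ k * prod ?\<rho> S"
    if S: "S \<subseteq> {..<m}" "card S = k" for S
  proof -
    have "prod ?p S * prod ?\<rho> S = (\<Prod>i\<in>S. \<alpha> * ?q i)"
      unfolding prod.distrib[symmetric] using \<alpha> by (intro prod.cong) auto
    also have "\<dots> = \<alpha> ^ k * prod ?q S" using S by (simp add: prod.distrib)
    finally have 1: "prod ?q S = prod ?p S * prod ?\<rho> S / \<alpha> ^ k" using \<alpha> by (simp add: field_simps)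
    have "prod ?p S * prod ?p ({..<m} - S) = prod ?p {..<m}"
      using S by (subst prod.subset_diff[of S "{..<m}"]) auto
    then show ?thesis unfolding 1 p[symmetric] by (simp add: mult_ac)
  qed
  then show ?thesis
    unfolding block_coeff_def sum_subsets_weight[OF r, symmetric] sum_distrib_left
    by (intro sum.cong) auto
qed

section \<open>Integrals against products of one-variable weights\<close>

context prob_cube
begin

definition bounded_measurable :: "(real \<Rightarrow> real) \<Rightarrow> bool" where
  "bounded_measurable u \<longleftrightarrow> u \<in> borel_measurable L \<and> (\<exists>B. \<forall>t\<in>space L. \<bar>u t\<bar> \<le> B)"

lemma bounded_measurableI:
  "u \<in> borel_measurable L \<Longrightarrow> (\<And>t. t \<in> space L \<Longrightarrow> \<bar>u t\<bar> \<le> B) \<Longrightarrow> bounded_measurable u"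
  by (auto simp: bounded_measurable_def)

lemma bounded_measurable_const [simp, intro]: "bounded_measurable (\<lambda>t. c)"
  by (rule bounded_measurableI[of _ "\<bar>c\<bar>"]) auto

lemma bounded_measurable_indicator [simp, intro]:
  "E \<in> sets L \<Longrightarrow> bounded_measurable (indicator E)"
  by (rule bounded_measurableI[of _ 1]) (auto simp: indicator_def)

lemma bounded_measurable_add [intro]:
  assumes "bounded_measurable u" "bounded_measurable v" shows "bounded_measurable (\<lambda>t. u t + v t)"
proof -
  from assms obtain A B where "\<forall>t\<in>space L. \<bar>u t\<bar> \<le> A" "\<forall>t\<in>space L. \<bar>v t\<bar> \<le> B"
    by (auto simp: bounded_measurable_def)
  then show ?thesis using assms
    by (intro bounded_measurableI[of _ "A + B"])
      (auto simp: bounded_measurable_def intro!: order_trans[OF abs_triangle_ineq] add_mono)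
qed

lemma bounded_measurable_mult [intro]:
  assumes "bounded_measurable u" "bounded_measurable v" shows "bounded_measurable (\<lambda>t. u t * v t)"
proof -
  from assms obtain A B where "\<forall>t\<in>space L. \<bar>u t\<bar> \<le> A" "\<forall>t\<in>space L. \<bar>v t\<bar> \<le> B"
    by (auto simp: bounded_measurable_def)
  then show ?thesis using assms
    by (intro bounded_measurableI[of _ "\<bar>A\<bar> * \<bar>B\<bar>"])
      (auto simp: bounded_measurable_def abs_mult intro!: mult_mono intro: order_trans[OF _ abs_ge_self])
qed

lemma bounded_measurable_diff [intro]:
  "bounded_measurable u \<Longrightarrow> bounded_measurable v \<Longrightarrow> bounded_measurable (\<lambda>t. u t - v t)"
  using bounded_measurable_add[OF _ bounded_measurable_mult[OF bounded_measurable_const, of v "-1"], of u] by simp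

lemma bounded_measurable_sum [intro]:
  "(\<And>i. i \<in> I \<Longrightarrow> bounded_measurable (u i)) \<Longrightarrow> bounded_measurable (\<lambda>t. \<Sum>i\<in>I. u i t)"
  by (induction I rule: infinite_finite_induct) auto

lemma integrable_bounded_measurable: "bounded_measurable u \<Longrightarrow> integrable L u"
proof -
  assume "bounded_measurable u"
  then obtain B where "u \<in> borel_measurable L" "\<forall>t\<in>space L. \<bar>u t\<bar> \<le> B"
    by (auto simp: bounded_measurable_def)
  then show ?thesis by (intro integrable_const_bound[of u B]) auto
qed

lemma measurable_prod_coords [measurable]:
  fixes u :: "nat \<Rightarrow> real \<Rightarrow> real"
  assumes "T \<subseteq> {..<m}" "\<And>i. i \<in> T \<Longrightarrow> u i \<in> borel_measurable L"
  shows "(\<lambda>x. \<Prod>i\<in>T. u i (x i)) \<in> borel_measurable (P m)"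
proof (rule borel_measurable_prod)
  fix i assume "i \<in> T"
  then show "(\<lambda>x. u i (x i)) \<in> borel_measurable (P m)"
    using assms by (intro measurable_compose[OF measurable_component_singleton, of i]) auto
qed

lemma integrable_mult_prod_coords:
  fixes f :: "(nat \<Rightarrow> real) \<Rightarrow> complex"
  assumes f: "integrable (P m) f" and T: "T \<subseteq> {..<m}" and u: "\<And>i. i \<in> T \<Longrightarrow> bounded_measurable (u i)"
  shows "integrable (P m) (\<lambda>x. f x * complex_of_real (\<Prod>i\<in>T. u i (x i)))"
proof -
  obtain B where B: "\<And>i t. i \<in> T \<Longrightarrow> t \<in> space L \<Longrightarrow> \<bar>u i t\<bar> \<le> B i"
    using u unfolding bounded_measurable_def by metis
  have m: "(\<lambda>x. \<Prod>i\<in>T. u i (x i)) \<in> borel_measurable (P m)"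
    by (rule measurable_prod_coords[OF T]) (use u in \<open>auto simp: bounded_measurable_def\<close>)
  show ?thesis
  proof (rule Bochner_Integration.integrable_bound[where f = "\<lambda>x. of_real (\<Prod>i\<in>T. B i) * f x"])
    show "integrable (P m) (\<lambda>x. of_real (\<Prod>i\<in>T. B i) * f x)" using f by auto
    show "(\<lambda>x. f x * complex_of_real (\<Prod>i\<in>T. u i (x i))) \<in> borel_measurable (P m)"
      by (rule borel_measurable_times[OF borel_measurable_integrable[OF f] measurable_compose[OF m borel_measurable_of_real]])
    show "AE x in P m. norm (f x * complex_of_real (\<Prod>i\<in>T. u i (x i))) \<le> norm (of_real (\<Prod>i\<in>T. B i) * f x)"
    proof (rule AE_I2)
      fix x assume x: "x \<in> space (P m)"
      have "\<bar>\<Prod>i\<in>T. u i (x i)\<bar> \<le> (\<Prod>i\<in>T. B i)"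
        unfolding abs_prod using x T B by (intro prod_mono) (auto simp: space_P)
      then have "norm (f x) * \<bar>\<Prod>i\<in>T. u i (x i)\<bar> \<le> norm (f x) * \<bar>\<Prod>i\<in>T. B i\<bar>"
        by (intro mult_left_mono order_trans[OF _ abs_ge_self]) auto
      then show "norm (f x * complex_of_real (\<Prod>i\<in>T. u i (x i))) \<le> norm (of_real (\<Prod>i\<in>T. B i) * f x)"
        by (simp only: norm_mult norm_of_real mult.commute)
    qed
  qed
qed

text \<open>The substitution along \<open>\<pi>\<close> preserves both the measure and
  \<open>f\<close>; only the assignment of factors to coordinates changes.\<close>

lemma integral_reindex_symmetric:
  fixes f :: "(nat \<Rightarrow> real) \<Rightarrow> complex"
  assumes f: "integrable (P m) f" "symmetric_on m f" and T: "T \<subseteq> {..<m}"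
    and u: "\<And>i. i \<in> T \<Longrightarrow> bounded_measurable (u i)" and \<pi>: "\<pi> permutes {..<m}"
  shows "(LINT x|P m. f x * complex_of_real (\<Prod>i\<in>T. u i (x (\<pi> i)))) = (LINT x|P m. f x * complex_of_real (\<Prod>i\<in>T. u i (x i)))"
proof -
  let ?r = "\<lambda>y. \<lambda>j\<in>{..<m}. y (\<pi> j)"
  have \<pi>': "\<pi> i < m \<longleftrightarrow> i < m" for i using permutes_in_image[OF \<pi>, of i] by simp
  have r: "?r \<in> P m \<rightarrow>\<^sub>M P m" by (rule measurable_reindex) (auto simp: \<pi>')
  have "(LINT x|P m. f x * complex_of_real (\<Prod>i\<in>T. u i (x i)))
      = (LINT x|distr (P m) (P m) ?r. f x * complex_of_real (\<Prod>i\<in>T. u i (x i)))"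
    using permutes_inj_on[OF \<pi>] \<pi>' by (subst distr_reindex) auto
  also have "\<dots> = (LINT x|P m. f (?r x) * complex_of_real (\<Prod>i\<in>T. u i (?r x i)))"
    using r integrable_mult_prod_coords[OF f(1) T u] by (intro integral_distr) auto
  also have "\<dots> = (LINT x|P m. f x * complex_of_real (\<Prod>i\<in>T. u i (x (\<pi> i))))"
  proof (intro Bochner_Integration.integral_cong refl arg_cong2[where f = "(*)"] arg_cong[where f = complex_of_real] prod.cong)
    fix x assume x: "x \<in> space (P m)"
    then have "?r x = x \<circ> \<pi>" using \<pi>' by (auto simp: space_P PiE_iff extensional_def fun_eq_iff)
    then show "f (?r x) = f x" using f(2) \<pi> x by (simp add: symmetric_on_def)
    show "u i (?r x i) = u i (x (\<pi> i))" if "i \<in> T" for i using that T by auto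
  qed
  finally show ?thesis by simp
qed

text \<open>Homogeneous of degree \<open>k\<close> in \<open>\<phi>\<close>: the diagonal of a
  \<open>k\<close>-linear form, symmetric when \<open>f\<close> is. Scaling separates the degrees,
  polarisation recovers the form.\<close>

definition power_moment :: "nat \<Rightarrow> ((nat \<Rightarrow> real) \<Rightarrow> complex) \<Rightarrow> nat \<Rightarrow> (real \<Rightarrow> real) \<Rightarrow> complex" where
  "power_moment m f k \<phi> = (LINT x|P m. f x * complex_of_real (\<Prod>i<k. \<phi> (x i)))"

lemma integral_prod_subset:
  assumes f: "integrable (P m) f" "symmetric_on m f" and S: "S \<subseteq> {..<m}"
    and \<phi>: "bounded_measurable \<phi>"
  shows "(LINT x|P m. f x * complex_of_real (\<Prod>i\<in>S. \<phi> (x i))) = power_moment m f (card S) \<phi>"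
proof -
  have fS: "finite S" by (rule finite_subset[OF S]) simp
  have km: "card S \<le> m" using card_mono[OF _ S] by simp
  obtain \<pi> where \<pi>: "\<pi> permutes {..<m}" "\<pi> ` {..<card S} = S"
    using ex_permutes_extension[OF bij_betw_sorted_list_of_set[OF fS] S] by metis
  have "(\<Prod>i\<in>S. \<phi> (x i)) = (\<Prod>i<card S. \<phi> (x (\<pi> i)))" for x
    using permutes_inj_on[OF \<pi>(1)] by (subst \<pi>(2)[symmetric], subst prod.reindex) auto
  then show ?thesis
    using integral_reindex_symmetric[OF f, of "{..<card S}" "\<lambda>_. \<phi>" \<pi>] \<pi> \<phi> km
    by (simp add: power_moment_def del: of_real_prod)
qed

lemma integral_prod_affine:
  assumes f: "integrable (P m) f" "symmetric_on m f" and \<phi>: "bounded_measurable \<phi>"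
  shows "(LINT x|P m. f x * complex_of_real (\<Prod>i<m. q i * \<phi> (x i) + p i))
    = (\<Sum>k\<le>m. complex_of_real (\<Sum>S\<in>{S \<in> Pow {..<m}. card S = k}. prod q S * prod p ({..<m} - S)) * power_moment m f k \<phi>)"
proof -
  let ?w = "\<lambda>S. prod q S * prod p ({..<m} - S)"
  have "(LINT x|P m. f x * complex_of_real (\<Prod>i<m. q i * \<phi> (x i) + p i))
     = (LINT x|P m. (\<Sum>S\<in>Pow {..<m}. complex_of_real (?w S) * (f x * complex_of_real (\<Prod>i\<in>S. \<phi> (x i)))))"
    by (subst prod_add) (auto simp: prod.distrib sum_distrib_left mult_ac intro!: Bochner_Integration.integral_cong)
  also have "\<dots> = (\<Sum>S\<in>Pow {..<m}. complex_of_real (?w S) * (LINT x|P m. f x * complex_of_real (\<Prod>i\<in>S. \<phi> (x i))))"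
    using \<phi> by (subst Bochner_Integration.integral_sum) (auto intro!: integrable_mult_prod_coords f integrable_mult_right simp del: of_real_prod)
  also have "\<dots> = (\<Sum>S\<in>Pow {..<m}. complex_of_real (?w S) * power_moment m f (card S) \<phi>)"
    by (intro sum.cong refl) (simp add: integral_prod_subset[OF f _ \<phi>] del: of_real_prod)
  also have "\<dots> = (\<Sum>k\<le>m. \<Sum>S\<in>{S \<in> Pow {..<m}. card S = k}. complex_of_real (?w S) * power_moment m f (card S) \<phi>)"
  proof (rule sum.group[symmetric])
    show "card ` Pow {..<m} \<subseteq> {..m}" using card_mono[of "{..<m}"] by fastforce
  qed auto
  also have "\<dots> = (\<Sum>k\<le>m. complex_of_real (\<Sum>S\<in>{S \<in> Pow {..<m}. card S = k}. ?w S) * power_moment m f k \<phi>)"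
    by (intro sum.cong refl) (simp add: sum_distrib_right)
  finally show ?thesis .
qed

lemma block_integral_expansion:
  assumes f: "integrable (P m) f" "symmetric_on m f" and \<phi>: "bounded_measurable \<phi>"
    and \<alpha>: "0 < \<alpha>" "\<alpha> < 1" and r: "r \<le> m"
  shows "(LINT x|P m. f x * complex_of_real (\<Prod>i<m. if i < m - r then \<alpha> + \<phi> (x i) else 1 - (\<alpha> + \<phi> (x i))))
    = (\<Sum>k\<le>m. complex_of_real (\<alpha> ^ (m - r) * (1 - \<alpha>) ^ r / \<alpha> ^ k * block_coeff m r \<alpha> k) * power_moment m f k \<phi>)"
proof -
  have "(\<Prod>i<m. if i < m - r then \<alpha> + \<phi> (x i) else 1 - (\<alpha> + \<phi> (x i)))
     = (\<Prod>i<m. (if i < m - r then 1 else -1) * \<phi> (x i) + (if i < m - r then \<alpha> else 1 - \<alpha>))" for x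
    by (intro prod.cong) auto
  then show ?thesis
    by (simp only: integral_prod_affine[OF f \<phi>] sum_block_weights[OF \<alpha> r])
qed

section \<open>Orthogonality of components with zero marginals to product weights\<close>

lemma integrable_subpt:
  fixes g :: "(nat \<Rightarrow> real) \<Rightarrow> complex"
  assumes g: "integrable (P (card S)) g" and S: "S \<subseteq> {..<m}"
  shows "integrable (P m) (\<lambda>x. g (subpt S x))"
    and "distr (P m) (P (card S)) (subpt S) = P (card S)" and "subpt S \<in> P m \<rightarrow>\<^sub>M P (card S)"
proof -
  have fS: "finite S" by (rule finite_subset[OF S]) simp
  note b = bij_betw_sorted_list_of_set[OF fS]
  have *: "inj_on ((!) (sorted_list_of_set S)) {..<card S}" "(!) (sorted_list_of_set S) \<in> {..<card S} \<rightarrow> {..<m}"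
    using bij_betw_imp_inj_on[OF b] bij_betw_imp_funcset[OF b] S by auto
  show 1: "distr (P m) (P (card S)) (subpt S) = P (card S)" and 2: "subpt S \<in> P m \<rightarrow>\<^sub>M P (card S)"
    using distr_reindex[OF *] measurable_reindex[OF *(2)] by (simp_all add: subpt_def[abs_def])
  show "integrable (P m) (\<lambda>x. g (subpt S x))"
    using integrable_distr[OF 2, of g] g 1 by simp
qed

text \<open>A coordinate of \<open>S\<close> outside \<open>T\<close> is not seen by the weight, and
  the marginal of \<open>g\<close> there is zero; a coordinate of \<open>T\<close> outside
  \<open>S\<close> is not seen by \<open>g\<close>, and its factor has mean zero. Means are thus
  restricted on \<open>T - S\<close> only, so plain indicators are admissible when \<open>T\<close>
  is a proper subset of \<open>S\<close>.\<close>

lemma integral_component_orthogonal: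
  fixes g :: "(nat \<Rightarrow> real) \<Rightarrow> complex"
  assumes g: "integrable (P (card S)) g" "\<And>i. i < card S \<Longrightarrow> AE z in P (card S). (LINT t|L. g (z(i := t))) = 0"
    and ST: "S \<subseteq> {..<m}" "T \<subseteq> {..<m}" "S \<noteq> T"
    and u: "\<And>i. i \<in> T \<Longrightarrow> bounded_measurable (u i)" "\<And>i. i \<in> T - S \<Longrightarrow> (LINT t|L. u i t) = 0"
  shows "(LINT x|P m. g (subpt S x) * complex_of_real (\<Prod>i\<in>T. u i (x i))) = 0"
proof -
  have fS: "finite S" by (rule finite_subset[OF ST(1)]) simp
  have fT: "finite T" by (rule finite_subset[OF ST(2)]) simp
  note gS = integrable_subpt[OF g(1) ST(1)]
  note int = integrable_mult_prod_coords[OF gS(1) ST(2), of u, OF u(1)]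
  note b = bij_betw_sorted_list_of_set[OF fS]
  from ST(3) consider i where "i \<in> S" "i \<notin> T" | i where "i \<in> T" "i \<notin> S" by auto
  then show ?thesis
  proof cases
    case 1
    then have "i \<in> (!) (sorted_list_of_set S) ` {..<card S}"
      using b by (simp add: bij_betw_def)
    then obtain j where j: "j < card S" "sorted_list_of_set S ! j = i" by auto
    have "(LINT x|P m. complex_of_real (\<Prod>i\<in>T. u i (x i)) * g (subpt S x)) = 0"
    proof (rule integral_vanish)
      show "i < m" using 1 ST by auto
      show "complex_of_real (\<Prod>j\<in>T. u j ((x(i := t)) j)) = complex_of_real (\<Prod>j\<in>T. u j (x j))" for x t
        using 1 by (intro arg_cong[where f = complex_of_real] prod.cong) auto
      have "AE x in distr (P m) (P (card S)) (subpt S). (LINT t|L. g (x(j := t))) = 0"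
        unfolding gS(2) by (rule g(2)[OF j(1)])
      from AE_distrD[OF gS(3) this] show "AE x in P m. (LINT t|L. g (subpt S (x(i := t)))) = 0"
      proof eventually_elim
        case (elim x)
        have "subpt S (x(i := t)) = (subpt S x)(j := t)" for t
          using j bij_betw_imp_inj_on[OF b] by (auto simp: subpt_def fun_eq_iff inj_on_def)
        then show ?case using elim by simp
      qed
    qed (use int in \<open>simp add: mult.commute del: of_real_prod\<close>)
    then show ?thesis by (simp add: mult.commute del: of_real_prod)
  next
    case 2
    \<comment> \<open>The roles are exchanged here: the factor in coordinate \<open>i\<close> is the
      function with zero average, and everything else is the weight that ignores
      \<open>i\<close>.\<close>
    have eq: "g (subpt S x) * complex_of_real (\<Prod>i\<in>T. u i (x i))
       = (g (subpt S x) * complex_of_real (\<Prod>i\<in>T - {i}. u i (x i))) * complex_of_real (u i (x i))" for x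
      using 2 fT by (simp add: prod.remove mult_ac)
    have "(LINT x|P m. (g (subpt S x) * complex_of_real (\<Prod>i\<in>T - {i}. u i (x i))) * complex_of_real (u i (x i))) = 0"
    proof (rule integral_vanish)
      show "i < m" using 2 ST by auto
      show "integrable (P m) (\<lambda>x. (g (subpt S x) * complex_of_real (\<Prod>i\<in>T - {i}. u i (x i))) * complex_of_real (u i (x i)))"
        using int by (simp only: eq)
      fix x :: "nat \<Rightarrow> real" and t :: real
      have "subpt S (x(i := t)) = subpt S x"
        using 2 bij_betw_apply[OF b] by (auto simp: subpt_def fun_eq_iff)
      then show "g (subpt S (x(i := t))) * complex_of_real (\<Prod>j\<in>T - {i}. u j ((x(i := t)) j))
          = g (subpt S x) * complex_of_real (\<Prod>j\<in>T - {i}. u j (x j))"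
        by (auto intro!: prod.cong)
    next
      show "AE x in P m. (LINT t|L. complex_of_real (u i ((x(i := t)) i))) = 0"
        using u(2)[of i] 2 by simp
    qed
    then show ?thesis by (simp only: eq)
  qed
qed

end

section \<open>Weak limits of product weights\<close>

lemma norm_integral_le_integral:
  fixes f :: "'a \<Rightarrow> 'b::{banach, second_countable_topology}"
  assumes "integrable M f" "integrable M g" "\<And>x. x \<in> space M \<Longrightarrow> norm (f x) \<le> g x"
  shows "norm (LINT x|M. f x) \<le> (LINT x|M. g x)"
  by (rule order_trans[OF integral_norm_bound integral_mono]) (use assms in auto)

text \<open>Dynkin's argument; the countable unions are handled by dominated convergence for series.\<close>

lemma set_integral_tendsto_generator:
  fixes G :: "nat \<Rightarrow> 'a \<Rightarrow> 'b::{real_normed_field, banach, second_countable_topology}"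
  assumes E: "E \<subseteq> sets M" "Int_stable E" "space M \<in> E"
    and int: "\<And>N. integrable M (G N)" "integrable M g" "integrable M H"
    and H: "\<And>N x. x \<in> space M \<Longrightarrow> norm (G N x) \<le> H x"
    and basic: "\<And>A. A \<in> E \<Longrightarrow> (\<lambda>N. LINT x:A|M. G N x) \<longlonglongrightarrow> (LINT x:A|M. g x)"
    and A: "A \<in> sigma_sets (space M) E"
  shows "(\<lambda>N. LINT x:A|M. G N x) \<longlonglongrightarrow> (LINT x:A|M. g x)"
proof -
  have ES: "sigma_sets (space M) E \<subseteq> sets M" by (rule sets.sigma_sets_subset[OF E(1)])
  have sint: "set_integrable M A f" if "A \<in> sets M" "integrable M f" for A and f :: "'a \<Rightarrow> 'c::{banach, second_countable_topology}"
    using that by (auto simp: set_integrable_def intro: integrable_mult_indicator)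
  have EP: "E \<subseteq> Pow (space M)"
    using sets.space_closed[of M] E(1) by auto
  from A show ?thesis
  proof (induction rule: sigma_sets_induct_disjoint[OF E(2) EP, consumes 1])
    case (1 A)
    then show ?case by (rule basic)
  next
    case 2
    show ?case by (simp add: set_lebesgue_integral_def)
  next
    case (3 A)
    have A: "A \<in> sets M" using 3 ES by auto
    have compl: "(LINT x:space M - A|M. f x) = (LINT x:space M|M. f x) - (LINT x:A|M. f x)"
      if "integrable M f" for f :: "'a \<Rightarrow> 'b"
    proof -
      have "(LINT x:(space M - A) \<union> A|M. f x) = (LINT x:space M - A|M. f x) + (LINT x:A|M. f x)"
        using that A by (intro set_integral_Un sint) auto
      moreover have "(space M - A) \<union> A = space M" using sets.sets_into_space[OF A] by auto
      ultimately show ?thesis by simp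
    qed
    \<comment> \<open>Complements need convergence of the total integrals, which is why the whole
      space must belong to \<open>E\<close>.\<close>
    show ?case unfolding compl[OF int(1)] compl[OF int(2)]
      using basic[OF E(3)] 3 by (intro tendsto_diff) auto
  next
    case (4 A)
    have A: "A i \<in> sets M" for i using 4 ES by auto
    then have UA: "(\<Union>i. A i) \<in> sets M" by auto
    have disj: "i \<noteq> j \<Longrightarrow> A i \<inter> A j = {}" for i j using 4 by (auto simp: disjoint_family_on_def)
    have ca: "(LINT x:(\<Union>i. A i)|M. f x) = (\<Sum>i. LINT x:A i|M. f x)" if "integrable M f" for f :: "'a \<Rightarrow> 'b"
      using that by (intro lebesgue_integral_countable_add A disj sint UA) auto
    have H0: "0 \<le> H x" if "x \<in> space M" for x using H[OF that, of 0] norm_ge_zero order_trans by blast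
    have HA: "integrable M (\<lambda>x. indicator (A i) x *\<^sub>R H x)" for i
      using sint[OF A int(3)] by (simp add: set_integrable_def)
    have summ: "summable (\<lambda>i. LINT x:A i|M. H x)"
    proof (rule summableI_nonneg_bounded)
      fix n
      show "0 \<le> (LINT x:A n|M. H x)"
        unfolding set_lebesgue_integral_def using H0 by (intro Bochner_Integration.integral_nonneg) auto
      have "(\<Sum>i<n. LINT x:A i|M. H x) = (LINT x:(\<Union>i<n. A i)|M. H x)"
        by (intro set_integral_finite_Union[symmetric] sint int A) (auto simp: disjoint_family_on_def disj)
      also have "\<dots> \<le> (LINT x|M. H x)"
        unfolding set_lebesgue_integral_def
      proof (intro integral_mono int)
        have "(\<Union>i<n. A i) \<in> sets M" using A by auto
        from sint[OF this int(3)] show "integrable M (\<lambda>x. indicator (\<Union>i<n. A i) x *\<^sub>R H x)"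
          by (simp add: set_integrable_def)
      qed (auto simp: indicator_def H0)
      finally show "(\<Sum>i<n. LINT x:A i|M. H x) \<le> (LINT x|M. H x)" .
    qed
    have bound: "norm (LINT x:A i|M. G N x) \<le> (LINT x:A i|M. H x)" for i N
      unfolding set_lebesgue_integral_def
    proof (rule norm_integral_le_integral)
      show "integrable M (\<lambda>x. indicator (A i) x *\<^sub>R G N x)"
        using sint[OF A int(1)] by (simp add: set_integrable_def)
    qed (use HA in \<open>auto simp: indicator_def H\<close>)
    show ?case unfolding ca[OF int(1)] ca[OF int(2)]
    proof (rule tannerys_theorem[THEN conjunct2, THEN conjunct2])
      show "\<forall>\<^sub>F (i, N) in at_top \<times>\<^sub>F sequentially. norm (LINT x:A i|M. G N x) \<le> (LINT x:A i|M. H x)"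
        using bound by (auto intro!: always_eventually)
    qed (use 4(3) summ in auto)
  qed
qed

context prob_cube
begin

lemma set_integral_tendsto_P:
  fixes G :: "nat \<Rightarrow> (nat \<Rightarrow> real) \<Rightarrow> 'b::{real_normed_field, banach, second_countable_topology}"
  assumes int: "\<And>N. integrable (P m) (G N)" "integrable (P m) g" "integrable (P m) H"
    and H: "\<And>N x. x \<in> space (P m) \<Longrightarrow> norm (G N x) \<le> H x"
    and basic: "\<And>E. (\<And>i. i < m \<Longrightarrow> E i \<in> sets L) \<Longrightarrow>
       (\<lambda>N. LINT x:PiE {..<m} E|P m. G N x) \<longlonglongrightarrow> (LINT x:PiE {..<m} E|P m. g x)"
    and A: "A \<in> sets (P m)"
  shows "(\<lambda>N. LINT x:A|P m. G N x) \<longlonglongrightarrow> (LINT x:A|P m. g x)"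
proof (rule set_integral_tendsto_generator[OF _ Int_stable_prod_algebra _ int H])
  show "A \<in> sigma_sets (space (P m)) (prod_algebra {..<m} (\<lambda>_. L))"
    using A by (simp add: sets_PiM space_PiM)
  show "prod_algebra {..<m} (\<lambda>_. L) \<subseteq> sets (P m)"
    by (auto simp: sets_PiM)
  show "space (P m) \<in> prod_algebra {..<m} (\<lambda>_. L)"
    unfolding space_P by (rule prod_algebraI_finite) auto
  fix A assume "A \<in> prod_algebra {..<m} (\<lambda>_. L)"
  then show "(\<lambda>N. LINT x:A|P m. G N x) \<longlonglongrightarrow> (LINT x:A|P m. g x)"
    by (auto simp: prod_algebra_eq_finite intro!: basic)
qed

lemma indicator_box:
  assumes "x \<in> space (P m)"
  shows "indicator (PiE {..<m} E) x = (\<Prod>i<m. indicator (E i) (x i) :: real)"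
proof (cases "x \<in> PiE {..<m} E")
  case True
  then show ?thesis by (auto simp: PiE_iff indicator_def intro!: prod.neutral[symmetric])
next
  case False
  then obtain i where "i < m" "x i \<notin> E i" using assms by (auto simp: space_P PiE_iff)
  then have "(\<Prod>i<m. indicator (E i) (x i) :: real) = 0" by (intro prod_zero bexI[of _ i]) auto
  then show ?thesis using False by simp
qed

lemma AE_zero_if_box_integrals_zero:
  fixes g :: "(nat \<Rightarrow> real) \<Rightarrow> complex"
  assumes g: "integrable (P m) g"
    and zero: "\<And>E. (\<And>i. i < m \<Longrightarrow> E i \<in> sets L) \<Longrightarrow> (LINT x|P m. g x * complex_of_real (\<Prod>i<m. indicator (E i) (x i))) = 0"
  shows "AE x in P m. g x = 0"
proof (rule P.density_zero[OF g])
  fix A assume A: "A \<in> sets (P m)"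
  \<comment> \<open>Convergence of the constant sequence 0 is equality of the integrals with 0, so
    the same extension from boxes to measurable sets gives uniqueness.\<close>
  have "(\<lambda>N. LINT x:A|P m. (0::complex)) \<longlonglongrightarrow> (LINT x:A|P m. g x)"
  proof (rule set_integral_tendsto_P[where G = "\<lambda>N x. 0" and H = "\<lambda>x. 0", OF _ g _ _ _ A])
    fix E :: "nat \<Rightarrow> real set" assume E: "\<And>i. i < m \<Longrightarrow> E i \<in> sets L"
    have "(LINT x:PiE {..<m} E|P m. g x) = (LINT x|P m. g x * complex_of_real (\<Prod>i<m. indicator (E i) (x i)))"
      unfolding set_lebesgue_integral_def
      by (intro Bochner_Integration.integral_cong refl) (simp add: indicator_box scaleR_conv_of_real mult.commute del: of_real_prod)
    then show "(\<lambda>N. LINT x:PiE {..<m} E|P m. (0::complex)) \<longlonglongrightarrow> (LINT x:PiE {..<m} E|P m. g x)"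
      using zero[OF E] by (simp add: set_lebesgue_integral_def)
  qed auto
  then show "(LINT x:A|P m. g x) = 0" by (simp add: set_lebesgue_integral_def LIMSEQ_const_iff)
qed

text \<open>On a box the integral of the weight is a product of one-variable integrals, and each of
  these converges. The uniform bound 1 extends this to all measurable sets, hence to simple
  functions, and by approximation in mean to every integrable \<open>f\<close>.\<close>

lemma integral_prod_coords_tendsto:
  fixes f :: "(nat \<Rightarrow> real) \<Rightarrow> complex"
  assumes w: "\<And>N i. w N i \<in> borel_measurable L" "\<And>i. v i \<in> borel_measurable L"
    and b: "\<And>N i t. t \<in> space L \<Longrightarrow> \<bar>w N i t\<bar> \<le> 1" "\<And>i t. t \<in> space L \<Longrightarrow> \<bar>v i t\<bar> \<le> 1"
    and lim: "\<And>i E. E \<in> sets L \<Longrightarrow> (\<lambda>N. LINT t:E|L. w N i t) \<longlonglongrightarrow> (LINT t:E|L. (v i t :: real))"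
    and f: "integrable (P m) f"
  shows "(\<lambda>N. LINT x|P m. f x * complex_of_real (\<Prod>i<m. w N i (x i)))
      \<longlonglongrightarrow> (LINT x|P m. f x * complex_of_real (\<Prod>i<m. v i (x i)))"
proof -
  let ?W = "\<lambda>N x. \<Prod>i<m. w N i (x i)" and ?V = "\<lambda>x. \<Prod>i<m. v i (x i)"
  have bw: "bounded_measurable (w N i)" and bv: "bounded_measurable (v i)" for N i
    using w b by (auto intro!: bounded_measurableI[of _ 1])
  have W1: "\<bar>?W N x\<bar> \<le> 1" and V1: "\<bar>?V x\<bar> \<le> 1" if "x \<in> space (P m)" for N x
    using that b by (auto simp: abs_prod space_P PiE_iff intro!: prod_le_1)
  have mW: "?W N \<in> borel_measurable (P m)" and mV: "?V \<in> borel_measurable (P m)" for N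
    using w by (auto intro!: measurable_prod_coords)
  have iW: "integrable (P m) (?W N)" and iV: "integrable (P m) ?V" for N
    using W1 V1 mW mV by (auto intro!: P.integrable_const_bound[where B = 1])
  have sets: "(\<lambda>N. LINT x:A|P m. ?W N x) \<longlonglongrightarrow> (LINT x:A|P m. ?V x)" if A: "A \<in> sets (P m)" for A
  proof (rule set_integral_tendsto_P[where H = "\<lambda>x. 1", OF iW iV _ _ _ A])
    fix E :: "nat \<Rightarrow> real set" assume E: "\<And>i. i < m \<Longrightarrow> E i \<in> sets L"
    have box: "(LINT x:PiE {..<m} E|P m. (\<Prod>i<m. u i (x i))) = (\<Prod>i<m. LINT t:E i|L. u i t)"
      if "\<And>i. bounded_measurable (u i)" for u
    proof -
      have "(LINT x:PiE {..<m} E|P m. (\<Prod>i<m. u i (x i))) = (LINT x|P m. (\<Prod>i<m. indicator (E i) (x i) * u i (x i)))"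
        unfolding set_lebesgue_integral_def
        by (intro Bochner_Integration.integral_cong refl) (simp add: indicator_box prod.distrib)
      also have "\<dots> = (\<Prod>i<m. LINT t|L. indicator (E i) t * u i t)"
        using E that by (intro product.product_integral_prod) (auto intro!: integrable_bounded_measurable)
      finally show ?thesis by (simp add: set_lebesgue_integral_def)
    qed
    show "(\<lambda>N. LINT x:PiE {..<m} E|P m. ?W N x) \<longlonglongrightarrow> (LINT x:PiE {..<m} E|P m. ?V x)"
      unfolding box[OF bw] box[OF bv] by (intro tendsto_prod lim E) auto
  qed (use W1 in auto)
  have int: "integrable (P m) (\<lambda>x. h x * complex_of_real (?W N x))"
    "integrable (P m) (\<lambda>x. h x * complex_of_real (?V x))" if "integrable (P m) h" for h N
    using that bw bv by (auto intro!: integrable_mult_prod_coords simp del: of_real_prod)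
  show ?thesis using f
  proof (induction rule: integrable_induct)
    case (base A c)
    have eq: "(LINT x|P m. (indicator A x *\<^sub>R c) * complex_of_real (U x)) = c * complex_of_real (LINT x:A|P m. U x)" for U
      unfolding set_lebesgue_integral_def
      by (subst integral_complex_of_real[symmetric], subst Bochner_Integration.integral_mult_right_zero[symmetric])
         (auto intro!: Bochner_Integration.integral_cong simp: scaleR_conv_of_real mult_ac)
    show ?case unfolding eq by (intro tendsto_intros sets base)
  next
    case (add f g)
    have eq: "(LINT x|P m. (f x + g x) * complex_of_real (U x)) = (LINT x|P m. f x * complex_of_real (U x)) + (LINT x|P m. g x * complex_of_real (U x))"
      if "integrable (P m) (\<lambda>x. f x * complex_of_real (U x))" "integrable (P m) (\<lambda>x. g x * complex_of_real (U x))" for U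
      using that by (simp add: distrib_right)
    show ?case unfolding eq[OF int(1)[OF add(1)] int(1)[OF add(2)]] eq[OF int(2)[OF add(1)] int(2)[OF add(2)]]
      by (intro tendsto_add add)
  next
    case (lim f s)
    \<comment> \<open>The simple approximants are bounded by twice \<open>norm (f x)\<close>, hence
      the factor 3 in the majorant.\<close>
    have "(\<lambda>i. LINT x|P m. norm (f x - s i x)) \<longlonglongrightarrow> (LINT x|P m. 0)"
    proof (rule integral_dominated_convergence[where w = "\<lambda>x. 3 * norm (f x)"])
      show "AE x in P m. (\<lambda>i. norm (f x - s i x)) \<longlonglongrightarrow> 0"
      proof (rule AE_I2)
        fix x assume "x \<in> space (P m)"
        from tendsto_norm[OF tendsto_diff[OF tendsto_const[of "f x"] lim(2)[OF this]]]
        show "(\<lambda>i. norm (f x - s i x)) \<longlonglongrightarrow> 0" by simp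
      qed
      show "AE x in P m. norm (norm (f x - s i x)) \<le> 3 * norm (f x)" for i
      proof (rule AE_I2)
        fix x assume "x \<in> space (P m)"
        then show "norm (norm (f x - s i x)) \<le> 3 * norm (f x)"
          using lim(3)[of x i] norm_triangle_ineq4[of "f x" "s i x"] by simp
      qed
    qed (use lim(1,4) in auto)
    then have conv: "(\<lambda>i. LINT x|P m. norm (f x - s i x)) \<longlonglongrightarrow> 0" by simp
    \<comment> \<open>The bound is the same for all weights \<open>U\<close>, so \<open>i\<close>
      can be fixed before \<open>N\<close> is chosen.\<close>
    have diff: "norm ((LINT x|P m. f x * complex_of_real (U x)) - (LINT x|P m. s i x * complex_of_real (U x)))
        \<le> (LINT x|P m. norm (f x - s i x))"
      if "integrable (P m) (\<lambda>x. f x * complex_of_real (U x))" "integrable (P m) (\<lambda>x. s i x * complex_of_real (U x))"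
        "\<And>x. x \<in> space (P m) \<Longrightarrow> \<bar>U x\<bar> \<le> 1" for U i
    proof -
      have "(LINT x|P m. f x * complex_of_real (U x)) - (LINT x|P m. s i x * complex_of_real (U x))
          = (LINT x|P m. f x * complex_of_real (U x) - s i x * complex_of_real (U x))"
        using that by simp
      also have "norm \<dots> \<le> (LINT x|P m. norm (f x - s i x))"
      proof (rule norm_integral_le_integral)
        fix x assume "x \<in> space (P m)"
        from that(3)[OF this] show "norm (f x * complex_of_real (U x) - s i x * complex_of_real (U x)) \<le> norm (f x - s i x)"
          by (simp flip: left_diff_distrib add: norm_mult mult_left_le)
      qed (use that lim(1,4) in auto)
      finally show ?thesis .
    qed
    show ?case
    proof (rule LIMSEQ_I)
      fix e :: real assume e: "0 < e"
      then obtain i where "norm ((LINT x|P m. norm (f x - s i x)) - 0) < e / 3"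
        using LIMSEQ_D[OF conv, of "e / 3"] by auto
      then have i: "(LINT x|P m. norm (f x - s i x)) < e / 3" by simp
      from LIMSEQ_D[OF lim(5)[of i], of "e / 3"] e obtain N0 where N0:
        "\<And>N. N \<ge> N0 \<Longrightarrow> norm ((LINT x|P m. s i x * complex_of_real (?W N x)) - (LINT x|P m. s i x * complex_of_real (?V x))) < e / 3"
        by auto
      show "\<exists>N0. \<forall>N\<ge>N0. norm ((LINT x|P m. f x * complex_of_real (?W N x)) - (LINT x|P m. f x * complex_of_real (?V x))) < e"
      proof (intro exI[of _ N0] allI impI)
        fix N assume N: "N \<ge> N0"
        let ?a = "LINT x|P m. f x * complex_of_real (?W N x)" and ?b = "LINT x|P m. s i x * complex_of_real (?W N x)"
        let ?c = "LINT x|P m. f x * complex_of_real (?V x)" and ?d = "LINT x|P m. s i x * complex_of_real (?V x)"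
        have "norm (?a - ?b) < e / 3"
          using diff[OF int(1)[OF lim(4)] int(1)[OF lim(1)] W1] i by (rule le_less_trans)
        moreover have "norm (?c - ?d) < e / 3"
          using diff[OF int(2)[OF lim(4)] int(2)[OF lim(1)] V1] i by (rule le_less_trans)
        moreover have "norm (?b - ?d) < e / 3" by (rule N0[OF N])
        moreover have "norm (?a - ?c) \<le> norm (?a - ?b) + norm (?b - ?d) + norm (?c - ?d)"
          using dist_triangle[of ?a ?c ?b] dist_triangle[of ?b ?c ?d] unfolding dist_norm
          by (simp only: norm_minus_commute)
        ultimately show "norm (?a - ?c) < e" by linarith
      qed
    qed
  qed
qed

end

section \<open>Vanishing of Hoeffding components\<close>

text \<open>Ryser's formula for the permanent of \<open>a\<close>: the maps on the right are exactly the permutations.\<close>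

lemma sum_prod_restrict_surj:
  fixes a :: "nat \<Rightarrow> nat \<Rightarrow> complex"
  shows "(\<Sum>I\<in>Pow {..<k}. (-1) ^ (k - card I) * (\<Prod>i<k. \<Sum>j\<in>I. a i j))
    = (\<Sum>g\<in>{g \<in> {..<k} \<rightarrow>\<^sub>E {..<k}. g ` {..<k} = {..<k}}. \<Prod>i<k. a i (g i))"
proof -
  let ?U = "{..<k}"
  let ?F = "?U \<rightarrow>\<^sub>E ?U"
  have fin: "finite ?F" by (intro finite_PiE) auto
  have "(\<Sum>I\<in>Pow ?U. (-1) ^ (k - card I) * (\<Prod>i<k. \<Sum>j\<in>I. a i j))
      = (\<Sum>I\<in>Pow ?U. \<Sum>g\<in>{g \<in> ?F. g ` ?U \<subseteq> I}. (-1) ^ (k - card I) * (\<Prod>i<k. a i (g i)))"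
  proof (intro sum.cong refl)
    fix I assume I: "I \<in> Pow ?U"
    have "{g \<in> ?F. g ` ?U \<subseteq> I} = ?U \<rightarrow>\<^sub>E I" using I by (auto simp: PiE_iff extensional_def)
    moreover have "(\<Prod>i<k. \<Sum>j\<in>I. a i j) = (\<Sum>g\<in>?U \<rightarrow>\<^sub>E I. \<Prod>i<k. a i (g i))"
      using I by (intro prod_sum_PiE) (auto intro: finite_subset)
    ultimately show "(-1) ^ (k - card I) * (\<Prod>i<k. \<Sum>j\<in>I. a i j)
       = (\<Sum>g\<in>{g \<in> ?F. g ` ?U \<subseteq> I}. (-1) ^ (k - card I) * (\<Prod>i<k. a i (g i)))"
      by (simp add: sum_distrib_left)
  qed
  also have "\<dots> = (\<Sum>g\<in>?F. \<Sum>I\<in>{I \<in> Pow ?U. g ` ?U \<subseteq> I}. (-1) ^ (k - card I) * (\<Prod>i<k. a i (g i)))"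
    using fin by (intro sum.swap_restrict) auto
  also have "\<dots> = (\<Sum>g\<in>?F. if g ` ?U = ?U then \<Prod>i<k. a i (g i) else 0)"
  proof (intro sum.cong refl)
    fix g assume "g \<in> ?F"
    then have gU: "g ` ?U \<subseteq> ?U" by auto
    have "(\<Sum>I\<in>{I \<in> Pow ?U. g ` ?U \<subseteq> I}. (-1) ^ (k - card I)) = (\<Sum>T\<in>Pow (?U - g ` ?U). (-1) ^ card T :: complex)"
    proof (rule sum.reindex_bij_witness[where i = "\<lambda>T. ?U - T" and j = "\<lambda>S. ?U - S"])
      fix I assume "I \<in> {I \<in> Pow ?U. g ` ?U \<subseteq> I}"
      then show "(-1) ^ card (?U - I) = ((-1) ^ (k - card I) :: complex)"
        by (simp add: card_Diff_subset finite_subset[of I ?U])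
    qed (use gU in auto)
    also have "\<dots> = (if g ` ?U = ?U then 1 else 0)"
      using sum_Pow_minus_one[of "?U - g ` ?U"] gU by auto
    finally show "(\<Sum>I\<in>{I \<in> Pow ?U. g ` ?U \<subseteq> I}. (-1) ^ (k - card I) * (\<Prod>i<k. a i (g i)))
       = (if g ` ?U = ?U then \<Prod>i<k. a i (g i) else 0)"
      by (simp flip: sum_distrib_right)
  qed
  also have "\<dots> = (\<Sum>g\<in>{g \<in> ?F. g ` ?U = ?U}. \<Prod>i<k. a i (g i))"
    using fin by (simp add: sum.inter_filter)
  finally show ?thesis .
qed

context prob_cube
begin

text \<open>The measure is required to be exactly \<open>\<alpha>\<close> for each \<open>N\<close>,
  not only in the limit, because the block integrals of \<open>f\<close> are known to vanish for
  such sets alone.\<close>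

definition weak_star_dense :: "real \<Rightarrow> bool" where
  "weak_star_dense \<alpha> \<longleftrightarrow> (\<forall>v \<in> borel_measurable L. (\<forall>t\<in>space L. 0 \<le> v t \<and> v t \<le> 1) \<longrightarrow> (LINT t|L. v t) = \<alpha> \<longrightarrow>
     (\<exists>A::nat \<Rightarrow> real set. (\<forall>N. A N \<in> sets L \<and> measure L (A N) = \<alpha>) \<and>
       (\<forall>E\<in>sets L. (\<lambda>N. LINT t:E|L. indicator (A N) t) \<longlonglongrightarrow> (LINT t:E|L. v t))))"

lemma block_integral_zero_dense:
  fixes f :: "(nat \<Rightarrow> real) \<Rightarrow> complex"
  assumes f: "integrable (P m) f" and dense: "weak_star_dense \<alpha>"
    and zero: "\<And>A. A \<in> sets L \<Longrightarrow> measure L A = \<alpha> \<Longrightarrow>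
      (LINT x|P m. f x * complex_of_real (\<Prod>i<m. if i < m - r then indicator A (x i) else 1 - indicator A (x i))) = 0"
    and v: "v \<in> borel_measurable L" "\<And>t. t \<in> space L \<Longrightarrow> 0 \<le> v t \<and> v t \<le> 1" "(LINT t|L. v t) = \<alpha>"
  shows "(LINT x|P m. f x * complex_of_real (\<Prod>i<m. if i < m - r then v (x i) else 1 - v (x i))) = 0"
proof -
  obtain A where A: "\<And>N. A N \<in> sets L" "\<And>N. measure L (A N) = \<alpha>"
    and lim: "\<And>E. E \<in> sets L \<Longrightarrow> (\<lambda>N. LINT t:E|L. indicator (A N) t) \<longlonglongrightarrow> (LINT t:E|L. v t)"
    using dense v unfolding weak_star_dense_def by metis
  let ?c = "\<lambda>u i t. if i < m - r then u t else 1 - u t :: real"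
  have "(\<lambda>N. LINT x|P m. f x * complex_of_real (\<Prod>i<m. ?c (indicator (A N)) i (x i)))
     \<longlonglongrightarrow> (LINT x|P m. f x * complex_of_real (\<Prod>i<m. ?c v i (x i)))"
  proof (rule integral_prod_coords_tendsto[OF _ _ _ _ _ f])
    fix i :: nat and E assume E: "E \<in> sets L"
    have compl: "(LINT t:E|L. 1 - u t) = (LINT t:E|L. 1) - (LINT t:E|L. u t)" if "bounded_measurable u" for u :: "real \<Rightarrow> real"
      using that E by (intro set_integral_diff) (auto simp: set_integrable_def intro!: integrable_bounded_measurable)
    have bv: "bounded_measurable v" by (rule bounded_measurableI[of _ 1]) (use v in auto)
    have bA: "bounded_measurable (indicator (A N))" for N using A by auto
    show "(\<lambda>N. LINT t:E|L. ?c (indicator (A N)) i t) \<longlonglongrightarrow> (LINT t:E|L. ?c v i t)"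
      using lim[OF E] by (cases "i < m - r") (auto simp: compl[OF bA] compl[OF bv] intro!: tendsto_diff)
  qed (use A v in \<open>auto simp: indicator_def\<close>)
  moreover have "(LINT x|P m. f x * complex_of_real (\<Prod>i<m. ?c (indicator (A N)) i (x i))) = 0" for N
    by (rule zero[OF A])
  ultimately show ?thesis by (simp add: LIMSEQ_const_iff)
qed

lemma power_moment_scale:
  "power_moment m f k (\<lambda>s. t * \<phi> s) = complex_of_real t ^ k * power_moment m f k \<phi>"
  unfolding power_moment_def
  by (subst Bochner_Integration.integral_mult_right_zero[symmetric])
     (auto intro!: Bochner_Integration.integral_cong simp: prod.distrib mult_ac)

lemma power_moment_zero:
  fixes f :: "(nat \<Rightarrow> real) \<Rightarrow> complex"
  assumes f: "integrable (P m) f" "symmetric_on m f" and dense: "weak_star_dense \<alpha>"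
    and \<alpha>: "0 < \<alpha>" "\<alpha> < 1" and r: "r \<le> m"
    and zero: "\<And>A. A \<in> sets L \<Longrightarrow> measure L A = \<alpha> \<Longrightarrow>
      (LINT x|P m. f x * complex_of_real (\<Prod>i<m. if i < m - r then indicator A (x i) else 1 - indicator A (x i))) = 0"
    and k: "k \<le> m" "block_coeff m r \<alpha> k \<noteq> 0"
    and \<phi>: "bounded_measurable \<phi>" "(LINT t|L. \<phi> t) = 0"
  shows "power_moment m f k \<phi> = 0"
proof -
  define c where "c k = complex_of_real (\<alpha> ^ (m - r) * (1 - \<alpha>) ^ r / \<alpha> ^ k * block_coeff m r \<alpha> k) * power_moment m f k \<phi>" for k
  obtain B0 where B0: "\<And>t. t \<in> space L \<Longrightarrow> \<bar>\<phi> t\<bar> \<le> B0" using \<phi>(1) by (auto simp: bounded_measurable_def)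
  define B where "B = max B0 1"
  have B: "B > 0" "\<And>t. t \<in> space L \<Longrightarrow> \<bar>\<phi> t\<bar> \<le> B" using B0 by (force simp: B_def)+
  \<comment> \<open>For \<open>t\<close> below this bound, \<open>\<alpha> + t * \<phi> s\<close>
    stays between 0 and 1, as the approximation by sets requires.\<close>
  define \<delta> where "\<delta> = min \<alpha> (1 - \<alpha>) / B"
  have \<delta>: "\<delta> > 0" using \<alpha> B by (simp add: \<delta>_def)
  have root: "(\<Sum>k\<le>m. c k * complex_of_real t ^ k) = 0" if t: "0 < t" "t < \<delta>" for t
  proof -
    have bt: "bounded_measurable (\<lambda>s. t * \<phi> s)" using \<phi> by auto
    have small: "\<bar>t * \<phi> s\<bar> \<le> min \<alpha> (1 - \<alpha>)" if "s \<in> space L" for s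
    proof -
      have "\<bar>t * \<phi> s\<bar> \<le> \<delta> * B" unfolding abs_mult using t B(2)[OF that] by (intro mult_mono) auto
      then show ?thesis using B by (simp add: \<delta>_def)
    qed
    have "(LINT x|P m. f x * complex_of_real (\<Prod>i<m. if i < m - r then \<alpha> + t * \<phi> (x i) else 1 - (\<alpha> + t * \<phi> (x i)))) = 0"
    proof (rule block_integral_zero_dense[OF f(1) dense zero])
      show "(\<lambda>s. \<alpha> + t * \<phi> s) \<in> borel_measurable L" using \<phi> by (auto simp: bounded_measurable_def)
      show "0 \<le> \<alpha> + t * \<phi> s \<and> \<alpha> + t * \<phi> s \<le> 1" if "s \<in> space L" for s
        using small[OF that] by (auto simp: abs_le_iff)
      show "(LINT s|L. \<alpha> + t * \<phi> s) = \<alpha>"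
        using integrable_bounded_measurable[OF \<phi>(1)] \<phi>(2) by (simp add: prob_space)
    qed
    then show ?thesis
      unfolding block_integral_expansion[OF f bt \<alpha> r] power_moment_scale c_def
      by (simp add: mult_ac)
  qed
  \<comment> \<open>A polynomial with a nonzero coefficient has finitely many roots, but a whole
    interval of values \<open>t\<close> are roots.\<close>
  have "c k = 0"
  proof (rule ccontr)
    assume "c k \<noteq> 0"
    then have "finite {x. (\<Sum>i\<le>m. c i * x ^ i) = 0}" using k(1) polyfun_finite_roots by blast
    moreover have "complex_of_real ` {0<..<\<delta>} \<subseteq> {x. (\<Sum>i\<le>m. c i * x ^ i) = 0}" using root by auto
    ultimately have "finite (complex_of_real ` {0<..<\<delta>})" by (rule finite_subset[rotated])
    then have "finite {0<..<\<delta>}" by (rule finite_imageD) (auto simp: inj_on_def)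
    then show False using \<delta> by (simp add: infinite_Ioo)
  qed
  then show ?thesis using k(2) \<alpha> by (simp add: c_def)
qed

text \<open>Polarisation. The signed sum of the moments of all partial sums of the
  \<open>\<phi> j\<close> retains exactly the assignments that use every index. Such an assignment
  permutes the first \<open>k\<close> coordinates, so by symmetry of \<open>f\<close> all surviving
  integrals are equal, and a nonzero multiple of the desired one is zero.\<close>

lemma integral_prod_zero:
  fixes f :: "(nat \<Rightarrow> real) \<Rightarrow> complex"
  assumes f: "integrable (P m) f" "symmetric_on m f" and k: "k \<le> m"
    and zero: "\<And>\<phi>. bounded_measurable \<phi> \<Longrightarrow> (LINT t|L. \<phi> t) = 0 \<Longrightarrow> power_moment m f k \<phi> = 0"
    and \<phi>: "\<And>i. i < k \<Longrightarrow> bounded_measurable (\<phi> i)" "\<And>i. i < k \<Longrightarrow> (LINT t|L. \<phi> i t) = 0"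
  shows "(LINT x|P m. f x * complex_of_real (\<Prod>i<k. \<phi> i (x i))) = 0"
proof -
  let ?U = "{..<k}"
  let ?F = "{g \<in> ?U \<rightarrow>\<^sub>E ?U. g ` ?U = ?U}"
  have finF: "finite ?F" by (rule finite_subset[of _ "?U \<rightarrow>\<^sub>E ?U"]) (auto intro: finite_PiE)
  have kU: "?U \<subseteq> {..<m}" using k by auto
  have bs: "bounded_measurable (\<lambda>t. \<Sum>j\<in>I. \<phi> j t)" if "I \<in> Pow ?U" for I
    using \<phi>(1) that by (intro bounded_measurable_sum) auto
  have "0 = (\<Sum>I\<in>Pow ?U. (-1) ^ (k - card I) * power_moment m f k (\<lambda>t. \<Sum>j\<in>I. \<phi> j t))"
  proof (intro sum.neutral[symmetric] ballI)
    fix I assume I: "I \<in> Pow ?U"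
    have "(LINT t|L. (\<Sum>j\<in>I. \<phi> j t)) = 0"
      using I \<phi> by (subst Bochner_Integration.integral_sum) (auto intro!: integrable_bounded_measurable sum.neutral)
    from zero[OF bs[OF I] this] show "(-1) ^ (k - card I) * power_moment m f k (\<lambda>t. \<Sum>j\<in>I. \<phi> j t) = 0" by simp
  qed
  also have "\<dots> = (LINT x|P m. (\<Sum>I\<in>Pow ?U. (-1) ^ (k - card I) * (f x * complex_of_real (\<Prod>i<k. \<Sum>j\<in>I. \<phi> j (x i)))))"
    unfolding power_moment_def
    by (subst Bochner_Integration.integral_sum)
       (auto intro!: integrable_mult_right integrable_mult_prod_coords[OF f(1) kU] bs simp del: of_real_prod of_real_sum)
  also have "\<dots> = (LINT x|P m. (\<Sum>g\<in>?F. f x * complex_of_real (\<Prod>i<k. \<phi> (g i) (x i))))"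
  proof (rule Bochner_Integration.integral_cong[OF refl])
    fix x
    have "(\<Sum>I\<in>Pow ?U. (-1) ^ (k - card I) * (f x * complex_of_real (\<Prod>i<k. \<Sum>j\<in>I. \<phi> j (x i))))
      = f x * (\<Sum>I\<in>Pow ?U. (-1) ^ (k - card I) * (\<Prod>i<k. \<Sum>j\<in>I. complex_of_real (\<phi> j (x i))))"
      by (simp add: sum_distrib_left mult_ac)
    then show "(\<Sum>I\<in>Pow ?U. (-1) ^ (k - card I) * (f x * complex_of_real (\<Prod>i<k. \<Sum>j\<in>I. \<phi> j (x i))))
      = (\<Sum>g\<in>?F. f x * complex_of_real (\<Prod>i<k. \<phi> (g i) (x i)))"
      unfolding sum_prod_restrict_surj by (simp add: sum_distrib_left)
  qed
  also have "\<dots> = (\<Sum>g\<in>?F. LINT x|P m. f x * complex_of_real (\<Prod>i<k. \<phi> (g i) (x i)))"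
    using \<phi>(1)
    by (subst Bochner_Integration.integral_sum)
       (auto intro!: integrable_mult_prod_coords[OF f(1) kU] simp del: of_real_prod)
  also have "\<dots> = (\<Sum>g\<in>?F. LINT x|P m. f x * complex_of_real (\<Prod>i<k. \<phi> i (x i)))"
  proof (intro sum.cong refl)
    fix g assume g: "g \<in> ?F"
    \<comment> \<open>\<open>g\<close> is extensional; continued by the identity it becomes a
      permutation of all \<open>m\<close> coordinates, the only kind that symmetry speaks
      of.\<close>
    define \<pi> where "\<pi> i = (if i < k then g i else i)" for i
    have img: "g ` ?U = ?U" using g by simp
    have inj: "inj_on g ?U" using img by (intro eq_card_imp_inj_on) auto
    have "bij_betw \<pi> ?U ?U"
      using inj img by (subst bij_betw_cong[of _ \<pi> g]) (auto simp: \<pi>_def bij_betw_def)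
    then have "\<pi> permutes ?U" by (rule bij_imp_permutes) (simp add: \<pi>_def)
    then have \<pi>: "\<pi> permutes {..<m}" by (rule permutes_subset[OF _ kU])
    have "(LINT x|P m. f x * complex_of_real (\<Prod>i<k. \<phi> i (x i))) = (LINT x|P m. f x * complex_of_real (\<Prod>i<k. \<phi> (g i) (x (\<pi> i))))"
    proof (intro Bochner_Integration.integral_cong refl arg_cong2[where f = "(*)"] arg_cong[where f = complex_of_real])
      fix x
      have "(\<Prod>j\<in>g ` ?U. \<phi> j (x j)) = (\<Prod>i<k. \<phi> (g i) (x (g i)))"
        by (subst prod.reindex[OF inj]) simp
      then show "(\<Prod>i<k. \<phi> i (x i)) = (\<Prod>i<k. \<phi> (g i) (x (\<pi> i)))"
        unfolding img by (simp add: \<pi>_def)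
    qed
    also have "\<dots> = (LINT x|P m. f x * complex_of_real (\<Prod>i<k. \<phi> (g i) (x i)))"
    proof (rule integral_reindex_symmetric[OF f kU _ \<pi>])
      show "bounded_measurable (\<phi> (g i))" if "i \<in> ?U" for i using \<phi>(1) g that by auto
    qed
    finally show "(LINT x|P m. f x * complex_of_real (\<Prod>i<k. \<phi> (g i) (x i))) = (LINT x|P m. f x * complex_of_real (\<Prod>i<k. \<phi> i (x i)))"
      by simp
  qed
  also have "\<dots> = of_nat (card ?F) * (LINT x|P m. f x * complex_of_real (\<Prod>i<k. \<phi> i (x i)))" by simp
  finally have "of_nat (card ?F) * (LINT x|P m. f x * complex_of_real (\<Prod>i<k. \<phi> i (x i))) = 0" by simp
  moreover have "card ?F \<noteq> 0"
  proof -
    have "restrict id ?U \<in> ?F" by auto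
    then have "?F \<noteq> {}" by blast
    then show ?thesis unfolding card_eq_0_iff using finF by blast
  qed
  ultimately show ?thesis by simp
qed

text \<open>Boxes are the test sets, but \<open>f\<close> is known to be orthogonal only to centred
  products. Centring the box indicators removes all components of \<open>f\<close> except that of
  \<open>{..<k}\<close>; for that component the centring can be undone, since its marginals are
  zero.\<close>

lemma hoeffding_AE_zero:
  fixes f :: "(nat \<Rightarrow> real) \<Rightarrow> complex"
  assumes f: "integrable (P m) f" "symmetric_on m f" and k: "k \<le> m"
    and zero: "\<And>\<phi>. bounded_measurable \<phi> \<Longrightarrow> (LINT t|L. \<phi> t) = 0 \<Longrightarrow> power_moment m f k \<phi> = 0"
  shows "AE z in P k. hoeffding m f k z = 0"
proof (rule AE_zero_if_box_integrals_zero)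
  show ih: "integrable (P k) (hoeffding m f k)" by (rule integrable_hoeffding[OF k f(1)])
  fix E :: "nat \<Rightarrow> real set" assume E: "\<And>i. i < k \<Longrightarrow> E i \<in> sets L"
  let ?U = "{..<k}"
  let ?g = "\<lambda>x. hoeffding m f k (subpt ?U x)"
  define e where "e i = measure L (E i)" for i
  \<comment> \<open>Written as a sum so that the product over the coordinates can be expanded over
    subsets.\<close>
  define \<phi> where "\<phi> i t = indicator (E i) t + (- e i)" for i t
  have kU: "?U \<subseteq> {..<m}" using k by auto
  have b\<phi>: "bounded_measurable (\<phi> i)" "(LINT t|L. \<phi> i t) = 0" if "i < k" for i
    using integrable_bounded_measurable[OF bounded_measurable_indicator[OF E[OF that]]] E[OF that]
    unfolding \<phi>_def by (auto simp: e_def prob_space simp del: add_uminus_conv_diff)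
  have orth: "(LINT x|P m. hoeffding m f (card S) (subpt S x) * complex_of_real (\<Prod>i\<in>T. u i (x i))) = 0"
    if "S \<subseteq> {..<m}" "T \<subseteq> {..<m}" "S \<noteq> T" "\<And>i. i \<in> T \<Longrightarrow> bounded_measurable (u i)"
      "\<And>i. i \<in> T - S \<Longrightarrow> (LINT t|L. u i t) = 0" for S T u
  proof -
    have cm: "card S \<le> m" using card_mono[OF _ that(1)] by simp
    show ?thesis
      by (rule integral_component_orthogonal[OF integrable_hoeffding[OF cm f(1)] hoeffding_marginal[OF cm _ f(1)] that])
  qed
  have intS: "integrable (P m) (\<lambda>x. hoeffding m f (card S) (subpt S x))" if "S \<subseteq> {..<m}" for S
    using integrable_subpt(1)[OF integrable_hoeffding[OF _ f(1)] that] card_mono[OF _ that] by simp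
  have "0 = (LINT x|P m. f x * complex_of_real (\<Prod>i<k. \<phi> i (x i)))"
    by (rule integral_prod_zero[OF f k zero, symmetric]) (use b\<phi> in auto)
  also have "\<dots> = (LINT x|P m. (\<Sum>S\<in>Pow {..<m}. hoeffding m f (card S) (subpt S x) * complex_of_real (\<Prod>i<k. \<phi> i (x i))))"
  proof (rule Bochner_Integration.integral_cong[OF refl])
    fix x assume x: "x \<in> space (P m)"
    show "f x * complex_of_real (\<Prod>i<k. \<phi> i (x i)) = (\<Sum>S\<in>Pow {..<m}. hoeffding m f (card S) (subpt S x) * complex_of_real (\<Prod>i<k. \<phi> i (x i)))"
      by (subst hoeffding_decomposition[OF x f]) (rule sum_distrib_right)
  qed
  also have "\<dots> = (\<Sum>S\<in>Pow {..<m}. LINT x|P m. hoeffding m f (card S) (subpt S x) * complex_of_real (\<Prod>i<k. \<phi> i (x i)))"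
    by (intro Bochner_Integration.integral_sum integrable_mult_prod_coords intS kU) (use b\<phi> in auto)
  also have "\<dots> = (\<Sum>S\<in>Pow {..<m}. if S = ?U then (LINT x|P m. ?g x * complex_of_real (\<Prod>i<k. \<phi> i (x i))) else 0)"
    using orth[OF _ kU, of _ \<phi>] b\<phi> by (intro sum.cong refl) (auto simp del: of_real_prod)
  also have "\<dots> = (LINT x|P m. ?g x * complex_of_real (\<Prod>i<k. \<phi> i (x i)))"
    using kU by (subst sum.delta) auto
  also have "\<dots> = (LINT x|P m. (\<Sum>T\<in>Pow ?U. complex_of_real (\<Prod>i\<in>?U - T. - e i) * (?g x * complex_of_real (\<Prod>i\<in>T. indicator (E i) (x i)))))"
    unfolding \<phi>_def by (subst prod_add) (auto intro!: Bochner_Integration.integral_cong simp: sum_distrib_left mult_ac)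
  also have "\<dots> = (\<Sum>T\<in>Pow ?U. complex_of_real (\<Prod>i\<in>?U - T. - e i) * (LINT x|P m. ?g x * complex_of_real (\<Prod>i\<in>T. indicator (E i) (x i))))"
  proof (subst Bochner_Integration.integral_sum)
    fix T assume "T \<in> Pow ?U"
    then show "integrable (P m) (\<lambda>x. complex_of_real (\<Prod>i\<in>?U - T. - e i) * (?g x * complex_of_real (\<Prod>i\<in>T. indicator (E i) (x i))))"
      using intS[OF kU] kU E by (intro integrable_mult_right integrable_mult_prod_coords) auto
  qed simp
  \<comment> \<open>Each proper subset \<open>T\<close> misses a coordinate of the component, whose
    marginal kills the term; no condition on the means of the indicators arises, as \<open>T\<close>
    lies inside \<open>?U\<close>.\<close>
  also have "\<dots> = (\<Sum>T\<in>Pow ?U. if T = ?U then (LINT x|P m. ?g x * complex_of_real (\<Prod>i<k. indicator (E i) (x i))) else 0)"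
  proof (intro sum.cong refl)
    fix T assume T: "T \<in> Pow ?U"
    show "complex_of_real (\<Prod>i\<in>?U - T. - e i) * (LINT x|P m. ?g x * complex_of_real (\<Prod>i\<in>T. indicator (E i) (x i)))
       = (if T = ?U then (LINT x|P m. ?g x * complex_of_real (\<Prod>i<k. indicator (E i) (x i))) else 0)"
    proof (cases "T = ?U")
      case False
      have "(LINT x|P m. hoeffding m f (card ?U) (subpt ?U x) * complex_of_real (\<Prod>i\<in>T. indicator (E i) (x i))) = 0"
        by (rule orth) (use T kU E False in auto)
      then show ?thesis using False by (simp del: of_real_prod)
    qed simp
  qed
  also have "\<dots> = (LINT x|P m. ?g x * complex_of_real (\<Prod>i<k. indicator (E i) (x i)))"
    by (subst sum.delta) auto
  also have "\<dots> = (LINT x|P m. ?g x * complex_of_real (\<Prod>i<k. indicator (E i) (subpt ?U x i)))"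
  proof -
    have "sorted_list_of_set ?U = [0..<k]" using sorted_list_of_set_range[of 0 k] by (simp add: lessThan_atLeast0)
    then have "subpt ?U x i = x i" if "i < k" for x i using that by (simp add: subpt_def)
    then show ?thesis by simp
  qed
  also have "\<dots> = (LINT z|distr (P m) (P (card ?U)) (subpt ?U). hoeffding m f k z * complex_of_real (\<Prod>i<k. indicator (E i) (z i)))"
    using integrable_subpt(3)[of ?U "hoeffding m f k" m] ih kU E
      integrable_mult_prod_coords[OF ih, of ?U "\<lambda>i. indicator (E i)"]
    by (intro integral_distr[symmetric]) (auto simp del: of_real_prod)
  also have "distr (P m) (P (card ?U)) (subpt ?U) = P k"
    using integrable_subpt(2)[of ?U "hoeffding m f k" m] ih kU by simp
  finally show "(LINT z|P k. hoeffding m f k z * complex_of_real (\<Prod>i<k. indicator (E i) (z i))) = 0" by simp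
qed

end

section \<open>Indicators are weak-* dense on the unit interval\<close>

abbreviation unit_measure :: "real measure" where
  "unit_measure \<equiv> lebesgue_on {0..1}"

lemma prob_space_unit: "prob_space unit_measure"
  by (rule prob_spaceI) (simp add: emeasure_restrict_space)

interpretation unit: prob_cube unit_measure
  by (rule prob_cube.intro) (rule prob_space_unit)

lemma sets_unit_borel: "S \<in> sets borel \<Longrightarrow> S \<subseteq> {0..1} \<Longrightarrow> S \<in> sets unit_measure"
  by (simp add: sets_restrict_space_iff)

lemma Icc_subset: "0 \<le> a \<Longrightarrow> b \<le> 1 \<Longrightarrow> {a..b} \<subseteq> {0..1::real}"
  by auto

lemma measure_unit_Ico: "0 \<le> a \<Longrightarrow> a \<le> b \<Longrightarrow> b \<le> 1 \<Longrightarrow> measure unit_measure {a..<b} = b - a"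
  by (subst measure_restrict_space) auto

lemma measure_unit_Icc: "0 \<le> a \<Longrightarrow> a \<le> b \<Longrightarrow> b \<le> 1 \<Longrightarrow> measure unit_measure {a..b} = b - a"
  by (subst measure_restrict_space) auto

text \<open>Initial segments generate only the Borel sets, while \<open>unit_measure\<close> also
  measures the other Lebesgue sets. Up to a null set the difference disappears, so weak convergence
  can be tested on initial segments.\<close>

lemma sets_unit_almost_borel:
  assumes E: "E \<in> sets unit_measure"
  obtains S where "S \<in> sigma_sets {0..1} (range (\<lambda>x. {0..1} \<inter> {..x}))" "AE t in unit_measure. t \<in> E \<longleftrightarrow> t \<in> S"
proof -
  have E': "E \<in> sets lebesgue" "E \<subseteq> {0..1}" using E by (auto simp: sets_restrict_space_iff)
  from E'(1) obtain S N N' where S: "E = S \<union> N" "N \<subseteq> N'" "N' \<in> null_sets lborel" "S \<in> sets lborel"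
    by (rule sets_completionE)
  have "AE t in lebesgue. t \<notin> N'" using S(3) by (intro AE_completion AE_not_in)
  then have ae: "AE t in unit_measure. t \<notin> N'"
    by (subst AE_restrict_space_iff) auto
  have sb: "sets (borel :: real measure) = sigma_sets UNIV (range (\<lambda>x. {..x}))"
    by (subst borel_eq_atMost) simp
  have *: "{0..1::real} \<in> sigma_sets UNIV (range (\<lambda>x. {..x}))"
    unfolding sb[symmetric] by (rule atLeastAtMost_borel)
  have "sigma_sets {0..1} ((\<inter>) {0..1} ` range (\<lambda>x::real. {..x})) = (\<inter>) {0..1} ` sigma_sets UNIV (range (\<lambda>x. {..x}))"
    by (rule sigma_sets_Int[OF * subset_UNIV, symmetric])
  moreover have "S \<in> sigma_sets UNIV (range (\<lambda>x. {..x}))"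
    unfolding sb[symmetric] using S(4) by simp
  moreover have "S = {0..1} \<inter> S" using S(1) E'(2) by auto
  ultimately have "S \<in> sigma_sets {0..1} (range (\<lambda>x. {0..1} \<inter> {..x}))"
    by (auto simp: image_image)
  moreover have "AE t in unit_measure. t \<in> E \<longleftrightarrow> t \<in> S" using ae by eventually_elim (use S in auto)
  ultimately show thesis using that by blast
qed

lemma ex_discretisation:
  fixes v :: "real \<Rightarrow> real" and n :: nat
  assumes v: "v \<in> borel_measurable unit_measure" "\<And>t. t \<in> {0..1} \<Longrightarrow> 0 \<le> v t \<and> v t \<le> 1" and n: "n > 0"
  obtains A where "A \<in> sets unit_measure" "measure unit_measure A = (LINT t|unit_measure. v t)"
    "\<And>x. \<bar>LINT t:{0..1} \<inter> {..x}|unit_measure. indicator A t - v t\<bar> \<le> 1 / n"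
proof -
  \<comment> \<open>Half-open cells are disjoint. They miss the point 1, which is accounted for in
    \<open>bound\<close> as a degenerate interval of length 0.\<close>
  define C where "C l = {real l / n..<real (Suc l) / n}" for l
  define d where "d l = (LINT t:C l|unit_measure. v t)" for l
  \<comment> \<open>On each cell of length \<open>1 / n\<close> the set \<open>A\<close> carries exactly the mass of \<open>v\<close>, so the error
    at \<open>x\<close> only comes from the cell containing \<open>x\<close>, and \<open>A\<close> has exactly the right measure.\<close>
  define A where "A = (\<Union>l<n. {real l / n..<real l / n + d l})"
  define h where "h t = indicator A t - v t" for t
  have sp: "space unit_measure = {0..1}" by simp
  have bv: "unit.bounded_measurable v" by (rule unit.bounded_measurableI[of _ 1]) (use v in auto)
  have le1: "real l / n \<le> 1" if "l \<le> n" for l using that n by simp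
  have Cs: "C l \<subseteq> {0..1}" if "l < n" for l
  proof
    fix x assume "x \<in> C l"
    then have "real l / n \<le> x" "x \<le> real (Suc l) / n" by (auto simp: C_def)
    moreover have "0 \<le> real l / n" by simp
    ultimately show "x \<in> {0..1}" using le1[of "Suc l"] that unfolding atLeastAtMost_iff by linarith
  qed
  have CS: "C l \<in> sets unit_measure" if "l < n" for l
    using Cs[OF that] by (intro sets_unit_borel) (auto simp: C_def)
  have d: "0 \<le> d l" "d l \<le> 1 / n" if "l < n" for l
  proof -
    show "0 \<le> d l" unfolding d_def set_lebesgue_integral_def
      using v by (intro Bochner_Integration.integral_nonneg) auto
    have "d l \<le> (LINT t|unit_measure. indicator (C l) t)"
      unfolding d_def set_lebesgue_integral_def
    proof (rule integral_mono)
      show "integrable unit_measure (\<lambda>t. indicator (C l) t *\<^sub>R v t)"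
        using CS[OF that] unit.integrable_bounded_measurable[OF bv] by (rule integrable_mult_indicator)
      show "integrable unit_measure (indicat_real (C l))"
        using CS[OF that] by (intro unit.integrable_bounded_measurable) auto
      show "indicat_real (C l) t *\<^sub>R v t \<le> indicat_real (C l) t" if "t \<in> space unit_measure" for t
        using v(2)[of t] that by (auto simp: indicator_def)
    qed
    also have "\<dots> = measure unit_measure (C l)"
    proof -
      have "C l \<inter> space unit_measure = C l" using Cs[OF that] by auto
      then show ?thesis by (simp only: Bochner_Integration.integral_indicator)
    qed
    also have "\<dots> = 1 / n"
    proof -
      have eq: "real (Suc l) / n - real l / n = 1 / n" and "real l / n \<le> real (Suc l) / n"
        by (simp_all add: add_divide_distrib)
      moreover have "0 \<le> real l / n" by simp
      moreover have "real (Suc l) / n \<le> 1" by (rule le1) (use that in simp)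
      ultimately have "measure unit_measure {real l / n..<real (Suc l) / n} = real (Suc l) / n - real l / n"
        by (intro measure_unit_Ico)
      then show ?thesis unfolding C_def eq .
    qed
    finally show "d l \<le> 1 / n" .
  qed
  have sub: "{real l / n..<real l / n + d l} \<subseteq> C l" if "l < n" for l
    using d[OF that] by (auto simp: C_def add_divide_distrib)
  have A1: "A \<subseteq> {0..1}" unfolding A_def using sub Cs by blast
  have AS: "A \<in> sets unit_measure" using A1 by (intro sets_unit_borel) (auto simp: A_def)
  have bh: "unit.bounded_measurable h" unfolding h_def using AS bv by auto
  have ih: "set_integrable unit_measure S h" if "S \<in> sets unit_measure" for S
    using that bh unfolding set_integrable_def by (auto intro!: unit.integrable_bounded_measurable)
  have AC: "A \<inter> C l = {real l / n..<real l / n + d l}" if "l < n" for l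
  proof -
    have "l' = l" if "l' < n" "t \<in> C l'" "t \<in> C l" for l' t
    proof -
      have "real l' / n < real (Suc l) / n" "real l / n < real (Suc l') / n"
        using that unfolding C_def by auto
      then have "l' < Suc l" "l < Suc l'" using n by (auto simp only: divide_less_cancel of_nat_less_iff)
      then show ?thesis by simp
    qed
    then have "A \<inter> C l \<subseteq> {real l / n..<real l / n + d l}"
      unfolding A_def using sub that by blast
    moreover have "{real l / n..<real l / n + d l} \<subseteq> A \<inter> C l"
      unfolding A_def using sub[OF that] that by blast
    ultimately show ?thesis by blast
  qed
  have hC: "(LINT t:C l|unit_measure. h t) = 0" if l: "l < n" for l
  proof -
    have "(LINT t:C l|unit_measure. h t) = (LINT t:C l|unit_measure. indicator A t) - d l"
      unfolding h_def d_def using CS[OF l] AS bv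
      by (intro set_integral_diff) (auto simp: set_integrable_def intro!: unit.integrable_bounded_measurable)
    also have "(LINT t:C l|unit_measure. indicator A t) = (LINT t|unit_measure. indicator (A \<inter> C l) t)"
      unfolding set_lebesgue_integral_def
      by (intro Bochner_Integration.integral_cong) (auto simp: indicator_def)
    also have "\<dots> = measure unit_measure (A \<inter> C l)"
    proof -
      have "A \<inter> C l \<inter> space unit_measure = A \<inter> C l" using A1 by auto
      then show ?thesis by (simp only: Bochner_Integration.integral_indicator)
    qed
    also have "\<dots> = d l"
    proof -
      have "real l / n + d l \<le> 1" using d[OF l] le1[of "Suc l"] l by (simp add: add_divide_distrib)
      then show ?thesis unfolding AC[OF l] using d[OF l] by (subst measure_unit_Ico) auto
    qed
    finally show ?thesis by simp
  qed
  have J: "{0..<real j / n} \<in> sets unit_measure" if "j \<le> n" for j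
  proof (rule sets_unit_borel)
    show "{0..<real j / n} \<subseteq> {0..1}" using le1[OF that] by force
  qed simp
  have h0: "(LINT t:{0..<real j / n}|unit_measure. h t) = 0" if "j \<le> n" for j
    using that
  proof (induction j)
    case 0
    then show ?case by (simp add: set_lebesgue_integral_def)
  next
    case (Suc j)
    have "0 \<le> real j / n" "real j / n \<le> real (Suc j) / n" by (auto intro: divide_right_mono)
    then have eq: "{0..<real (Suc j) / n} = {0..<real j / n} \<union> C j"
      unfolding C_def by (rule ivl_disj_un_two(3)[symmetric])
    have "{0..<real j / n} \<in> sets unit_measure"
      using Suc.prems by (intro J) simp
    then show ?case unfolding eq using Suc CS[of j] hC[of j]
      by (subst set_integral_Un) (auto intro!: ih simp: C_def)
  qed
  \<comment> \<open>Up to the grid point \<open>real j / n\<close> the integral of \<open>h\<close>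
    is zero, and beyond it \<open>h\<close> is at most 1 in absolute value.\<close>
  have bound: "\<bar>LINT t:{0..x}|unit_measure. h t\<bar> \<le> x - real j / n" if x: "x \<le> 1" "real j / n \<le> x" "j \<le> n" for x j
  proof -
    have j0: "0 \<le> real j / n" by simp
    have s: "{0..<real j / n} \<in> sets unit_measure" "{real j / n..x} \<in> sets unit_measure"
    proof -
      show "{0..<real j / n} \<in> sets unit_measure" by (rule J[OF x(3)])
      have "{real j / n..x} \<subseteq> {0..1}" by (rule Icc_subset[OF j0 x(1)])
      then show "{real j / n..x} \<in> sets unit_measure" by (rule sets_unit_borel[rotated]) simp
    qed
    have eq: "{0..x} = {0..<real j / n} \<union> {real j / n..x}"
      by (rule ivl_disj_un_two(7)[OF j0 x(2), symmetric])
    have "(LINT t:{0..x}|unit_measure. h t) = (LINT t:{real j / n..x}|unit_measure. h t)"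
      unfolding eq using h0[OF x(3)] s by (subst set_integral_Un) (auto intro!: ih)
    also have "\<bar>\<dots>\<bar> \<le> (LINT t|unit_measure. indicator {real j / n..x} t)"
      unfolding set_lebesgue_integral_def real_norm_def[symmetric]
    proof (rule norm_integral_le_integral)
      show "integrable unit_measure (\<lambda>t. indicator {real j / n..x} t *\<^sub>R h t)"
        using ih[OF s(2)] by (simp add: set_integrable_def)
      show "integrable unit_measure (indicat_real {real j / n..x})"
        using s by (intro unit.integrable_bounded_measurable) auto
      show "norm (indicator {real j / n..x} t *\<^sub>R h t) \<le> indicator {real j / n..x} t" if "t \<in> space unit_measure" for t
        using v(2)[of t] that by (auto simp: h_def indicator_def)
    qed
    also have "\<dots> = x - real j / n" using s x j0 by (simp add: measure_unit_Icc)
    finally show ?thesis .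
  qed
  show thesis
  proof
    show "A \<in> sets unit_measure" by (rule AS)
    \<comment> \<open>At \<open>x = 1\<close> and \<open>j = n\<close> the error bound is 0, so the
      measure of \<open>A\<close> is exact.\<close>
    have "(LINT t:{0..1}|unit_measure. h t) = 0" using bound[of 1 n] n by simp
    also have "(LINT t:{0..1}|unit_measure. h t) = (LINT t|unit_measure. h t)"
      unfolding set_lebesgue_integral_def by (intro Bochner_Integration.integral_cong) auto
    also have "\<dots> = measure unit_measure A - (LINT t|unit_measure. v t)"
      unfolding h_def using AS unit.integrable_bounded_measurable[OF bv]
        unit.integrable_bounded_measurable[OF unit.bounded_measurable_indicator[OF AS]] A1
      by (simp add: Int_absorb2)
    finally show "measure unit_measure A = (LINT t|unit_measure. v t)" by simp
    fix x :: real
    show "\<bar>LINT t:{0..1} \<inter> {..x}|unit_measure. indicator A t - v t\<bar> \<le> 1 / n"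
    proof (cases "x < 0")
      case True
      then have "{0..1} \<inter> {..x} = {}" by auto
      then show ?thesis by (simp add: set_lebesgue_integral_def)
    next
      case False
      \<comment> \<open>\<open>x\<close> is cut off at 1, and \<open>j\<close> numbers the last grid
        point not beyond \<open>y\<close>; for \<open>y = 1\<close> this is
        \<open>n\<close>.\<close>
      define y where "y = min x 1"
      define j where "j = nat \<lfloor>n * y\<rfloor>"
      have y: "0 \<le> y" "y \<le> 1" using False by (auto simp: y_def)
      have ny: "0 \<le> n * y" "n * y \<le> n" using y n by (auto simp: mult_left_le)
      have j: "real j \<le> n * y" "n * y < real j + 1" using ny unfolding j_def by linarith+
      then have "j \<le> n" using ny by linarith
      moreover have "real j / n \<le> y" "y \<le> (real j + 1) / n"
        using j n by (simp_all add: pos_divide_le_eq pos_le_divide_eq mult.commute)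
      moreover from this have "y - real j / n \<le> 1 / n" by (simp add: add_divide_distrib)
      moreover have "{0..1} \<inter> {..x} = {0..y}" by (auto simp: y_def)
      ultimately show ?thesis using bound[of y j] y by (simp add: h_def)
    qed
  qed
qed

text \<open>Discretisation with \<open>Suc N\<close> cells makes the error on initial segments at
  most \<open>1 / Suc N\<close>. Initial segments are closed under intersection and include the
  whole interval, so convergence passes to the sets they generate, and from there to Lebesgue sets
  by changing a null set.\<close>

lemma weak_star_dense_unit: "unit.weak_star_dense \<alpha>"
  unfolding unit.weak_star_dense_def
proof (intro ballI impI)
  fix v :: "real \<Rightarrow> real"
  assume v: "v \<in> borel_measurable unit_measure" "\<forall>t\<in>space unit_measure. 0 \<le> v t \<and> v t \<le> 1"
    and \<alpha>: "(LINT t|unit_measure. v t) = \<alpha>"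
  define Q where "Q N B \<longleftrightarrow> B \<in> sets unit_measure \<and> measure unit_measure B = \<alpha> \<and>
    (\<forall>x. \<bar>LINT t:{0..1} \<inter> {..x}|unit_measure. indicator B t - v t\<bar> \<le> 1 / real (Suc N))" for N B
  have "\<exists>B. Q N B" for N
  proof -
    have v': "\<And>t. t \<in> {0..1} \<Longrightarrow> 0 \<le> v t \<and> v t \<le> 1" using v(2) by simp
    obtain B where "B \<in> sets unit_measure" "measure unit_measure B = (LINT t|unit_measure. v t)"
      "\<And>x. \<bar>LINT t:{0..1} \<inter> {..x}|unit_measure. indicator B t - v t\<bar> \<le> 1 / real (Suc N)"
      using ex_discretisation[OF v(1) v' zero_less_Suc[of N]] by blast
    then show ?thesis unfolding \<alpha> Q_def by blast
  qed
  then obtain A where "\<And>N. Q N (A N)" by metis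
  then have A: "\<And>N. A N \<in> sets unit_measure" "\<And>N. measure unit_measure (A N) = \<alpha>"
    "\<And>N x. \<bar>LINT t:{0..1} \<inter> {..x}|unit_measure. indicator (A N) t - v t\<bar> \<le> 1 / real (Suc N)"
    by (auto simp: Q_def)
  have bv: "unit.bounded_measurable v" by (rule unit.bounded_measurableI[of _ 1]) (use v in auto)
  have iA: "integrable unit_measure (indicat_real (A N))" for N
    using A by (intro unit.integrable_bounded_measurable) auto
  have iv: "integrable unit_measure v" by (rule unit.integrable_bounded_measurable[OF bv])
  have si: "set_integrable unit_measure S u" if "S \<in> sets unit_measure" "integrable unit_measure u" for S and u :: "real \<Rightarrow> real"
    using that unfolding set_integrable_def by (rule integrable_mult_indicator)
  let ?G = "range (\<lambda>x::real. {0..1} \<inter> {..x})"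
  have GS: "?G \<subseteq> sets unit_measure" by (auto intro!: sets_unit_borel)
  have "(\<lambda>N. LINT t:E|unit_measure. indicator (A N) t) \<longlonglongrightarrow> (LINT t:E|unit_measure. v t)" if E: "E \<in> sets unit_measure" for E
  proof -
    obtain S where S: "S \<in> sigma_sets {0..1} ?G" "AE t in unit_measure. t \<in> E \<longleftrightarrow> t \<in> S"
      by (rule sets_unit_almost_borel[OF E])
    have SS: "S \<in> sets unit_measure" using S(1) sets.sigma_sets_subset[OF GS] by auto
    have ES: "(LINT t:E|unit_measure. u t) = (LINT t:S|unit_measure. u t)" if "integrable unit_measure u" for u :: "real \<Rightarrow> real"
      unfolding set_lebesgue_integral_def
    proof (rule integral_cong_AE)
      show "AE t in unit_measure. indicat_real E t *\<^sub>R u t = indicat_real S t *\<^sub>R u t"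
        using S(2) by eventually_elim (auto simp: indicator_def)
    qed (use that E SS in auto)
    have "(\<lambda>N. LINT t:S|unit_measure. indicator (A N) t) \<longlonglongrightarrow> (LINT t:S|unit_measure. v t)"
    proof (rule set_integral_tendsto_generator[OF GS _ _ iA iv])
      show "Int_stable ?G"
      proof (rule Int_stableI)
        fix a b assume "a \<in> ?G" "b \<in> ?G"
        then obtain x y where "a = {0..1} \<inter> {..x}" "b = {0..1} \<inter> {..y}" by auto
        then have "a \<inter> b = {0..1} \<inter> {..min x y}" by auto
        then show "a \<inter> b \<in> ?G" by blast
      qed
      have "{0..1} = {0..1} \<inter> {..1::real}" by auto
      then show "space unit_measure \<in> ?G" by auto
      show "integrable unit_measure (\<lambda>t. 1::real)" by simp
      show "S \<in> sigma_sets (space unit_measure) ?G" using S(1) by simp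
      fix B assume "B \<in> ?G"
      then obtain x where x: "B = {0..1} \<inter> {..x}" by auto
      then have BS: "B \<in> sets unit_measure" using GS by auto
      have "(\<lambda>N. (LINT t:B|unit_measure. indicator (A N) t) - (LINT t:B|unit_measure. v t)) \<longlonglongrightarrow> 0"
      proof (rule tendsto_rabs_zero_cancel, rule tendsto_sandwich[OF _ _ tendsto_const LIMSEQ_inverse_real_of_nat])
        have "\<bar>(LINT t:B|unit_measure. indicator (A N) t) - (LINT t:B|unit_measure. v t)\<bar> \<le> inverse (real (Suc N))" for N
          using A(3)[where x = x and N = N] set_integral_diff(2)[OF si[OF BS iA] si[OF BS iv]] x by (simp add: inverse_eq_divide)
        then show "\<forall>\<^sub>F N in sequentially. \<bar>(LINT t:B|unit_measure. indicator (A N) t) - (LINT t:B|unit_measure. v t)\<bar> \<le> inverse (real (Suc N))"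
          by (intro always_eventually allI)
      qed auto
      then show "(\<lambda>N. LINT t:B|unit_measure. indicator (A N) t) \<longlonglongrightarrow> (LINT t:B|unit_measure. v t)"
        by (simp add: LIM_zero_iff)
    qed (auto simp: indicator_def)
    then show ?thesis using ES[OF iA] ES[OF iv] by simp
  qed
  with A show "\<exists>A. (\<forall>N. A N \<in> sets unit_measure \<and> measure unit_measure (A N) = \<alpha>) \<and>
     (\<forall>E\<in>sets unit_measure. (\<lambda>N. LINT t:E|unit_measure. indicator (A N) t) \<longlonglongrightarrow> (LINT t:E|unit_measure. v t))"
    by blast
qed

section \<open>Transfer to the completed cube\<close>

lemma AE_measure_preserving:
  assumes "T \<in> M \<rightarrow>\<^sub>M N" "distr M N T = N" "AE x in N. Q x"
  shows "AE x in M. Q (T x)"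
  by (rule AE_distrD[OF assms(1)]) (simp only: assms)

lemma completion_ex_integrable_complex:
  fixes f :: "'a \<Rightarrow> complex"
  assumes f: "integrable (completion M) f"
  obtains g where "integrable M g" "AE x in M. f x = g x"
proof -
  have mf: "f \<in> borel_measurable (completion M)" using f by auto
  then have mRe: "(\<lambda>x. Re (f x)) \<in> borel_measurable (completion M)" and mIm: "(\<lambda>x. Im (f x)) \<in> borel_measurable (completion M)"
    by auto
  obtain a b where ab: "a \<in> borel_measurable M" "AE x in M. Re (f x) = a x" "b \<in> borel_measurable M" "AE x in M. Im (f x) = b x"
    using completion_ex_borel_measurable_real[OF mRe] completion_ex_borel_measurable_real[OF mIm] by blast
  define g where "g x = complex_of_real (a x) + \<i> * complex_of_real (b x)" for x
  have mg: "g \<in> borel_measurable M" using ab by (auto simp: g_def[abs_def])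
  have ae: "AE x in M. f x = g x"
    using ab(2,4) by eventually_elim (simp add: g_def complex_eq_iff)
  have "integrable (completion M) g"
    by (rule integrable_cong_AE_imp[OF f measurable_completion[OF mg]]) (rule AE_completion, use ae in eventually_elim, simp)
  then show thesis using that mg ae by (simp add: integrable_completion)
qed

text \<open>Rests on completeness of Lebesgue measure; extension by zero moves the question from
  \<open>S\<close> to the whole line.\<close>

lemma borel_measurable_AE_lebesgue_on:
  fixes u w :: "real \<Rightarrow> complex"
  assumes w: "w \<in> borel_measurable (lebesgue_on S)" and S: "S \<in> sets lebesgue" and ae: "AE t in lebesgue_on S. w t = u t"
  shows "u \<in> borel_measurable (lebesgue_on S)"
proof -
  have "(\<lambda>t. if t \<in> S then w t else 0) \<in> borel_measurable lebesgue"
    by (rule borel_measurable_if[OF S, THEN iffD2, OF w])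
  moreover have "AE t in lebesgue. (if t \<in> S then w t else 0) = (if t \<in> S then u t else 0)"
  proof -
    have "AE t in lebesgue. t \<in> S \<longrightarrow> w t = u t"
      using ae S by (subst (asm) AE_restrict_space_iff) auto
    then show ?thesis by eventually_elim auto
  qed
  ultimately have "(\<lambda>t. if t \<in> S then u t else 0) \<in> borel_measurable lebesgue"
    by (rule borel_measurable_AE)
  then show ?thesis by (rule borel_measurable_if[OF S, THEN iffD1])
qed

context prob_cube
begin

lemma AE_reindex:
  assumes "inj_on \<pi> {..<k}" "\<pi> \<in> {..<k} \<rightarrow> {..<m}" "AE x in P k. Q x"
  shows "AE x in P m. Q (\<lambda>j\<in>{..<k}. x (\<pi> j))"
  by (rule AE_measure_preserving[OF measurable_reindex[OF assms(2)] distr_reindex[OF assms(1,2)] assms(3)])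

lemma restrict_comp_permutes:
  assumes "\<sigma> permutes {..<m}" "x \<in> space (P m)"
  shows "(\<lambda>j\<in>{..<m}. x (\<sigma> j)) = x \<circ> \<sigma>"
proof
  fix j
  show "(\<lambda>j\<in>{..<m}. x (\<sigma> j)) j = (x \<circ> \<sigma>) j"
    using assms permutes_not_in[OF assms(1), of j]
    by (auto simp: space_P PiE_iff extensional_def)
qed

text \<open>A product-measurable version of \<open>f\<close> need not be symmetric. Averaging it
  over all permutations makes it symmetric at every point, and it still agrees with \<open>f\<close>
  almost everywhere because \<open>f\<close> is its own average.\<close>

lemma ex_symmetric_version:
  fixes f g :: "(nat \<Rightarrow> real) \<Rightarrow> complex"
  assumes f: "symmetric_on m f" and g: "integrable (P m) g" and ae: "AE x in P m. f x = g x"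
  obtains h where "integrable (P m) h" "symmetric_on m h" "AE x in P m. f x = h x"
proof -
  let ?S = "{\<sigma>. \<sigma> permutes {..<m}}"
  let ?r = "\<lambda>\<sigma> x. \<lambda>j\<in>{..<m}. x (\<sigma> j)"
  define h where "h x = (\<Sum>\<sigma>\<in>?S. g (?r \<sigma> x)) / of_nat (card ?S)" for x
  have fin: "finite ?S" by (rule finite_permutations) simp
  have card: "card ?S \<noteq> 0"
  proof -
    have "id \<in> ?S" by (simp add: permutes_id)
    then have "?S \<noteq> {}" by blast
    then show ?thesis using fin by simp
  qed
  have p: "inj_on \<sigma> {..<m}" "\<sigma> \<in> {..<m} \<rightarrow> {..<m}" if "\<sigma> \<in> ?S" for \<sigma>
  proof -
    have \<sigma>: "\<sigma> permutes {..<m}" using that by simp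
    show "inj_on \<sigma> {..<m}" by (rule permutes_inj_on[OF \<sigma>])
    show "\<sigma> \<in> {..<m} \<rightarrow> {..<m}" using permutes_in_image[OF \<sigma>] by blast
  qed
  have "integrable (P m) (\<lambda>x. g (?r \<sigma> x))" if "\<sigma> \<in> ?S" for \<sigma>
  proof (rule integrable_distr[OF measurable_reindex[OF p(2)[OF that]]])
    show "integrable (distr (P m) (P m) (?r \<sigma>)) g"
      unfolding distr_reindex[OF p[OF that]] by (rule g)
  qed
  then have "integrable (P m) h" unfolding h_def[abs_def] by (intro integrable_divide Bochner_Integration.integrable_sum)
  moreover have "symmetric_on m h"
    unfolding symmetric_on_def
  proof (intro allI impI ballI)
    fix \<tau> x assume \<tau>: "\<tau> permutes {..<m}" and x: "x \<in> space (P m)"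
    have "(\<Sum>\<sigma>\<in>?S. g (?r \<sigma> (x \<circ> \<tau>))) = (\<Sum>\<sigma>\<in>?S. g (?r (\<tau> \<circ> \<sigma>) x))" by simp
    also have "\<dots> = (\<Sum>\<sigma>\<in>?S. g (?r \<sigma> x))"
      by (rule setum_permutations_compose_left[OF \<tau>, symmetric])
    finally show "h (x \<circ> \<tau>) = h x" by (simp add: h_def)
  qed
  moreover have "AE x in P m. f x = h x"
  proof -
    have "AE x in P m. \<forall>\<sigma>\<in>?S. f (?r \<sigma> x) = g (?r \<sigma> x)"
      by (rule AE_finite_allI[OF fin]) (rule AE_reindex[OF p ae])
    then show ?thesis
    proof (rule AE_mp, intro AE_I2 impI)
      fix x assume x: "x \<in> space (P m)" and eq: "\<forall>\<sigma>\<in>?S. f (?r \<sigma> x) = g (?r \<sigma> x)"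
      have "g (?r \<sigma> x) = f x" if "\<sigma> \<in> ?S" for \<sigma>
      proof -
        have \<sigma>: "\<sigma> permutes {..<m}" using that by simp
        have "g (?r \<sigma> x) = f (?r \<sigma> x)" using eq that by simp
        also have "\<dots> = f x"
          unfolding restrict_comp_permutes[OF \<sigma> x] using f \<sigma> x by (simp add: symmetric_on_def)
        finally show ?thesis .
      qed
      then show "f x = h x" using card by (simp add: h_def)
    qed
  qed
  ultimately show thesis by (rule that)
qed

end

text \<open>\<open>g\<close> is only measurable for the completion, so its sections are measurable only almost surely;
  this needs completeness of Lebesgue measure.\<close>

lemma marginal_cong_AE:
  fixes g h :: "(nat \<Rightarrow> real) \<Rightarrow> complex"
  assumes h: "integrable (unit.P k) h" and ae: "AE z in unit.P k. g z = h z" and i: "i < k"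
    and g: "AE y in unit.P k. (LINT t|unit_measure. g (y(i := t))) = 0"
  shows "AE y in unit.P k. (LINT t|unit_measure. h (y(i := t))) = 0"
proof -
  interpret pair_sigma_finite "unit.P k" unit_measure ..
  have "AE p in unit.P k \<Otimes>\<^sub>M unit_measure. g ((\<lambda>(x, t). x(i := t)) p) = h ((\<lambda>(x, t). x(i := t)) p)"
    by (rule AE_measure_preserving[OF unit.measurable_update[OF i] unit.distr_update[OF i] ae])
  from AE_pair[OF this] have "AE y in unit.P k. AE t in unit_measure. g (y(i := t)) = h (y(i := t))" by simp
  with g show ?thesis
  proof (rule AE_mp[OF _ AE_mp], intro AE_I2 impI)
    fix y assume y: "y \<in> space (unit.P k)" and 0: "(LINT t|unit_measure. g (y(i := t))) = 0"
      and eq: "AE t in unit_measure. g (y(i := t)) = h (y(i := t))"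
    have "(\<lambda>t. (y, t)) \<in> unit_measure \<rightarrow>\<^sub>M unit.P k \<Otimes>\<^sub>M unit_measure"
      using y by simp
    from measurable_compose[OF this unit.measurable_update[OF i]]
    have "(\<lambda>t. y(i := t)) \<in> unit_measure \<rightarrow>\<^sub>M unit.P k" by simp
    from measurable_compose[OF this, of h] have mh: "(\<lambda>t. h (y(i := t))) \<in> borel_measurable unit_measure"
      using h by auto
    have "(\<lambda>t. g (y(i := t))) \<in> borel_measurable unit_measure"
      by (rule borel_measurable_AE_lebesgue_on[OF mh]) (use eq in auto)
    from integral_cong_AE[OF this mh eq] 0 show "(LINT t|unit_measure. h (y(i := t))) = 0" by simp
  qed
qed

section \<open>The characterisation on the completed cube\<close>

lemma space_cube: "space (cube m) = space (unit.P m)"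
  by (simp add: cube_def)

text \<open>The block is already measurable for the uncompleted product, so both the passage to the
  completion and the choice of version leave the integral unchanged.\<close>

lemma block_integral_eq:
  fixes f h :: "(nat \<Rightarrow> real) \<Rightarrow> complex"
  assumes f: "integrable (cube m) f" and h: "integrable (unit.P m) h" and ae: "AE x in unit.P m. f x = h x"
    and A: "A \<in> sets unit_measure"
  shows "(LINT x : block m r A | cube m. f x)
    = (LINT x|unit.P m. h x * complex_of_real (\<Prod>i<m. if i < m - r then indicator A (x i) else 1 - indicator A (x i)))"
proof -
  let ?E = "\<lambda>i. if i < m - r then A else {0..1} - A"
  have E: "?E i \<in> sets unit_measure" for i
    using A sets.compl_sets[OF A] by auto
  have B: "block m r A \<in> sets (unit.P m)" unfolding block_def using E by (intro sets_PiM_I_finite) auto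
  have mh: "(\<lambda>x. indicator (block m r A) x *\<^sub>R h x) \<in> borel_measurable (unit.P m)" using B h by auto
  have "(LINT x : block m r A | cube m. f x) = (LINT x|cube m. indicator (block m r A) x *\<^sub>R h x)"
    unfolding set_lebesgue_integral_def
  proof (rule integral_cong_AE)
    show "(\<lambda>x. indicat_real (block m r A) x *\<^sub>R f x) \<in> borel_measurable (cube m)"
      using B f by (auto simp: cube_def intro!: borel_measurable_scaleR borel_measurable_indicator)
    show "(\<lambda>x. indicat_real (block m r A) x *\<^sub>R h x) \<in> borel_measurable (cube m)"
      unfolding cube_def by (rule measurable_completion[OF mh])
    show "AE x in cube m. indicat_real (block m r A) x *\<^sub>R f x = indicat_real (block m r A) x *\<^sub>R h x"
      unfolding cube_def by (rule AE_completion, use ae in eventually_elim, simp)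
  qed
  also have "\<dots> = (LINT x|unit.P m. indicator (block m r A) x *\<^sub>R h x)"
    unfolding cube_def by (rule integral_completion[OF mh])
  also have "\<dots> = (LINT x|unit.P m. h x * complex_of_real (\<Prod>i<m. if i < m - r then indicator A (x i) else 1 - indicator A (x i)))"
  proof (rule Bochner_Integration.integral_cong[OF refl])
    fix x assume x: "x \<in> space (unit.P m)"
    have "indicat_real (block m r A) x = (\<Prod>i<m. indicator (?E i) (x i))"
      unfolding block_def by (rule unit.indicator_box[OF x])
    also have "\<dots> = (\<Prod>i<m. if i < m - r then indicator A (x i) else 1 - indicator A (x i))"
      using x by (intro prod.cong) (auto simp: unit.space_P PiE_iff indicator_def)
    finally show "indicator (block m r A) x *\<^sub>R h x = h x * complex_of_real (\<Prod>i<m. if i < m - r then indicator A (x i) else 1 - indicator A (x i))"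
      by (simp add: scaleR_conv_of_real mult.commute del: of_real_prod)
  qed
  finally show ?thesis .
qed

text \<open>The index 0 is excluded automatically, its coefficient being 1. In particular the
  constant component of \<open>f\<close> is among those forced to vanish.\<close>

lemma Kset_iff: "k \<in> Kset m r \<alpha> \<longleftrightarrow> k \<le> m \<and> block_coeff m r \<alpha> k = 0"
proof -
  have "block_coeff m r \<alpha> 0 = 1" by (simp add: block_coeff_def)
  then show ?thesis by (cases "k = 0") (auto simp: Kset_def block_coeff_def)
qed

lemma sum_Pow_by_card:
  fixes F :: "nat set \<Rightarrow> complex"
  assumes "K \<subseteq> {..m}" and "\<And>S. S \<subseteq> {..<m} \<Longrightarrow> card S \<notin> K \<Longrightarrow> F S = 0"
  shows "(\<Sum>S\<in>Pow {..<m}. F S) = (\<Sum>k\<in>K. \<Sum>S | S \<subseteq> {..<m} \<and> card S = k. F S)"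
proof -
  have "(\<Sum>S\<in>Pow {..<m}. F S) = (\<Sum>S\<in>{S \<in> Pow {..<m}. card S \<in> K}. F S)"
    using assms(2) by (intro sum.mono_neutral_right) auto
  also have "\<dots> = (\<Sum>k\<in>K. \<Sum>S\<in>{S \<in> {S \<in> Pow {..<m}. card S \<in> K}. card S = k}. F S)"
    using assms(1) by (intro sum.group[symmetric]) (auto intro: finite_subset[OF assms(1)])
  also have "\<dots> = (\<Sum>k\<in>K. \<Sum>S | S \<subseteq> {..<m} \<and> card S = k. F S)"
    by (intro sum.cong) auto
  finally show ?thesis .
qed

theorem mainTheorem4:
  fixes \<alpha> :: real and m r :: nat and f :: "(nat \<Rightarrow> real) \<Rightarrow> complex"
  assumes "0 < \<alpha>" and "\<alpha> < 1" and "1 \<le> m" and "r \<le> m"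
    and "symmetric_fun m f" and "integrable (cube m) f"
  shows "(\<forall>A \<in> sets (lebesgue_on {0..1::real}). measure lebesgue A = \<alpha> \<longrightarrow>
            (LINT x : block m r A | cube m. f x) = 0)
     \<longleftrightarrow> ((AE x in cube m. f x = 0) \<or>
          (\<exists>g :: nat \<Rightarrow> (nat \<Rightarrow> real) \<Rightarrow> complex.
             (\<forall>k \<in> Kset m r \<alpha>. symmetric_fun k (g k) \<and> integrable (cube k) (g k) \<and>
                (\<forall>i < k. AE y in cube k. (LINT t | lebesgue_on {0..1::real}. g k (y(i := t))) = 0)) \<and>
             (AE x in cube m. f x = (\<Sum>k \<in> Kset m r \<alpha>. \<Sum>S | S \<subseteq> {..<m} \<and> card S = k. g k (subpt S x)))))"
    (is "?zero \<longleftrightarrow> ?triv \<or> ?decomp")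
proof -
  let ?K = "Kset m r \<alpha>"
  have symm: "symmetric_fun k u \<longleftrightarrow> unit.symmetric_on k u" for k and u :: "(nat \<Rightarrow> real) \<Rightarrow> complex"
    by (simp add: symmetric_fun_def unit.symmetric_on_def space_cube)
  obtain h0 where h0: "integrable (unit.P m) h0" "AE x in unit.P m. f x = h0 x"
    using completion_ex_integrable_complex[of "unit.P m" f] assms(6) unfolding cube_def by blast
  obtain h where h: "integrable (unit.P m) h" "unit.symmetric_on m h" and fh: "AE x in unit.P m. f x = h x"
    using unit.ex_symmetric_version[OF assms(5)[unfolded symm] h0] by blast
  note block = block_integral_eq[OF assms(6) h(1) fh]
  have meas: "measure lebesgue A = measure unit_measure A" if "A \<in> sets unit_measure" for A
    using that by (subst measure_restrict_space) (auto simp: sets_restrict_space_iff)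
  have KM: "?K \<subseteq> {..m}" and finK: "finite ?K" by (auto simp: Kset_def)
  show ?thesis
  proof (intro iffI)
    assume zero: ?zero
    \<comment> \<open>The components of the symmetric version \<open>h\<close> are the witnesses;
      those with index outside \<open>?K\<close> turn out to be null.\<close>
    let ?g = "unit.hoeffding m h"
    have "AE z in unit.P k. ?g k z = 0" if k: "k \<le> m" "k \<notin> ?K" for k
    proof (rule unit.hoeffding_AE_zero[OF h k(1)])
      fix \<phi> assume \<phi>: "unit.bounded_measurable \<phi>" "(LINT t|unit_measure. \<phi> t) = 0"
      have c: "block_coeff m r \<alpha> k \<noteq> 0" using k by (simp add: Kset_iff)
      show "unit.power_moment m h k \<phi> = 0"
      proof (rule unit.power_moment_zero[OF h weak_star_dense_unit assms(1,2,4) _ k(1) c \<phi>])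
        fix A assume A: "A \<in> sets unit_measure" "measure unit_measure A = \<alpha>"
        then show "(LINT x|unit.P m. h x * complex_of_real (\<Prod>i<m. if i < m - r then indicator A (x i) else 1 - indicator A (x i))) = 0"
          using zero meas[OF A(1)] block[OF A(1), of r] by simp
      qed
    qed
    note null = this
    have "AE x in unit.P m. \<forall>S\<in>{S \<in> Pow {..<m}. card S \<notin> ?K}. ?g (card S) (subpt S x) = 0"
    proof (rule AE_finite_allI)
      fix S assume S: "S \<in> {S \<in> Pow {..<m}. card S \<notin> ?K}"
      then have Sm: "S \<subseteq> {..<m}" and c: "card S \<le> m" using card_mono[of "{..<m}" S] by auto
      note sp = unit.integrable_subpt[OF unit.integrable_hoeffding[OF c h(1)] Sm]
      show "AE x in unit.P m. ?g (card S) (subpt S x) = 0"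
        using S by (intro AE_measure_preserving[OF sp(3,2) null[OF c]]) simp
    qed simp
    with fh have "AE x in unit.P m. f x = (\<Sum>k\<in>?K. \<Sum>S | S \<subseteq> {..<m} \<and> card S = k. ?g k (subpt S x))"
    proof (rule AE_mp[OF _ AE_mp], intro AE_I2 impI)
      fix x assume x: "x \<in> space (unit.P m)" and fx: "f x = h x"
        and nx: "\<forall>S\<in>{S \<in> Pow {..<m}. card S \<notin> ?K}. ?g (card S) (subpt S x) = 0"
      have "h x = (\<Sum>S\<in>Pow {..<m}. ?g (card S) (subpt S x))" by (rule unit.hoeffding_decomposition[OF x h])
      also have "\<dots> = (\<Sum>k\<in>?K. \<Sum>S | S \<subseteq> {..<m} \<and> card S = k. ?g (card S) (subpt S x))"
        using nx by (intro sum_Pow_by_card[OF KM]) auto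
      also have "\<dots> = (\<Sum>k\<in>?K. \<Sum>S | S \<subseteq> {..<m} \<and> card S = k. ?g k (subpt S x))"
        by (intro sum.cong) auto
      finally show "f x = (\<Sum>k\<in>?K. \<Sum>S | S \<subseteq> {..<m} \<and> card S = k. ?g k (subpt S x))" using fx by simp
    qed
    moreover have "symmetric_fun k (?g k) \<and> integrable (cube k) (?g k) \<and>
        (\<forall>i<k. AE y in cube k. (LINT t|unit_measure. ?g k (y(i := t))) = 0)" if "k \<in> ?K" for k
    proof -
      have k: "k \<le> m" using that by (simp add: Kset_iff)
      note ig = unit.integrable_hoeffding[OF k h(1)]
      show ?thesis
      proof (intro conjI allI impI)
        show "symmetric_fun k (?g k)" unfolding symm by (rule unit.hoeffding_symmetric[OF k h])
        show "integrable (cube k) (?g k)"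
          unfolding cube_def using ig by (simp add: integrable_completion)
        fix i assume "i < k"
        show "AE y in cube k. (LINT t|unit_measure. ?g k (y(i := t))) = 0"
          unfolding cube_def by (rule AE_completion[OF unit.hoeffding_marginal[OF k \<open>i < k\<close> h(1)]])
      qed
    qed
    ultimately have ?decomp unfolding cube_def by (intro exI[of _ ?g] conjI ballI AE_completion) auto
    then show "?triv \<or> ?decomp" ..
  next
    assume "?triv \<or> ?decomp"
    then show ?zero
    proof
      assume ?triv
      then have "AE x in unit.P m. f x = 0" unfolding cube_def by (simp add: AE_completion_iff)
      with fh have h00: "AE x in unit.P m. h x = 0" by eventually_elim simp
      show ?zero
      proof (intro ballI impI)
        fix A :: "real set" assume A: "A \<in> sets unit_measure"
        show "(LINT x : block m r A | cube m. f x) = 0"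
          unfolding block[OF A] by (rule integral_eq_zero_AE, use h00 in eventually_elim, simp)
      qed
    next
      assume ?decomp
      then obtain g where g: "\<And>k. k \<in> ?K \<Longrightarrow> integrable (cube k) (g k)"
          "\<And>k i. k \<in> ?K \<Longrightarrow> i < k \<Longrightarrow> AE y in cube k. (LINT t|unit_measure. g k (y(i := t))) = 0"
        and fg: "AE x in cube m. f x = (\<Sum>k\<in>?K. \<Sum>S | S \<subseteq> {..<m} \<and> card S = k. g k (subpt S x))"
        by blast
      \<comment> \<open>The given \<open>g k\<close> are integrable for the completion only;
        \<open>u k\<close> are product-measurable versions to which Fubini applies.\<close>
      have "\<exists>u. integrable (unit.P k) u \<and> (AE x in unit.P k. g k x = u x)" if "k \<in> ?K" for k
        using completion_ex_integrable_complex[of "unit.P k" "g k"] g(1)[OF that] unfolding cube_def by blast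
      then obtain u where u: "\<And>k. k \<in> ?K \<Longrightarrow> integrable (unit.P k) (u k)"
        "\<And>k. k \<in> ?K \<Longrightarrow> AE x in unit.P k. g k x = u k x" by metis
      have um: "AE y in unit.P k. (LINT t|unit_measure. u k (y(i := t))) = 0" if k: "k \<in> ?K" "i < k" for k i
        by (rule marginal_cong_AE[OF u(1)[OF k(1)] u(2)[OF k(1)] k(2)])
          (rule AE_completion_iff[THEN iffD1, OF g(2)[OF k, unfolded cube_def]])
      have "AE x in unit.P m. \<forall>S\<in>{S \<in> Pow {..<m}. card S \<in> ?K}. g (card S) (subpt S x) = u (card S) (subpt S x)"
      proof (rule AE_finite_allI)
        fix S assume S: "S \<in> {S \<in> Pow {..<m}. card S \<in> ?K}"
        then have Sm: "S \<subseteq> {..<m}" and c: "card S \<in> ?K" by auto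
        note sp = unit.integrable_subpt[OF u(1)[OF c] Sm]
        show "AE x in unit.P m. g (card S) (subpt S x) = u (card S) (subpt S x)"
          by (rule AE_measure_preserving[OF sp(3,2) u(2)[OF c]])
      qed simp
      moreover have "AE x in unit.P m. f x = (\<Sum>k\<in>?K. \<Sum>S | S \<subseteq> {..<m} \<and> card S = k. g k (subpt S x))"
        by (rule AE_completion_iff[THEN iffD1, OF fg[unfolded cube_def]])
      ultimately have hu: "AE x in unit.P m. h x = (\<Sum>k\<in>?K. \<Sum>S | S \<subseteq> {..<m} \<and> card S = k. u (card S) (subpt S x))"
        using fh
      proof eventually_elim
        case (elim x)
        have "h x = (\<Sum>k\<in>?K. \<Sum>S | S \<subseteq> {..<m} \<and> card S = k. g k (subpt S x))" using elim by simp
        also have "\<dots> = (\<Sum>k\<in>?K. \<Sum>S | S \<subseteq> {..<m} \<and> card S = k. u (card S) (subpt S x))"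
          using elim(1) by (intro sum.cong) auto
        finally show ?case .
      qed
      have int_u: "integrable (unit.P m) (\<lambda>x. u (card S) (subpt S x))" if "S \<subseteq> {..<m}" "card S \<in> ?K" for S
        by (rule unit.integrable_subpt(1)[OF u(1)[OF that(2)] that(1)])
      have moment: "unit.power_moment m h k \<phi> = 0"
        if k: "k \<le> m" "k \<notin> ?K" and \<phi>: "unit.bounded_measurable \<phi>" "(LINT t|unit_measure. \<phi> t) = 0" for k \<phi>
      proof -
        let ?w = "\<lambda>x. complex_of_real (\<Prod>i<k. \<phi> (x i))"
        have kU: "{..<k} \<subseteq> {..<m}" using k by auto
        have intw: "integrable (unit.P m) (\<lambda>x. v x * ?w x)" if "integrable (unit.P m) v" for v
          by (rule unit.integrable_mult_prod_coords[OF that kU]) (rule \<phi>(1))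
        have "unit.power_moment m h k \<phi> = (LINT x|unit.P m. (\<Sum>k\<in>?K. \<Sum>S | S \<subseteq> {..<m} \<and> card S = k. u (card S) (subpt S x) * ?w x))"
          unfolding unit.power_moment_def
        proof (rule integral_cong_AE)
          show "(\<lambda>x. h x * ?w x) \<in> borel_measurable (unit.P m)" using intw[OF h(1)] by (rule borel_measurable_integrable)
          show "(\<lambda>x. \<Sum>k\<in>?K. \<Sum>S | S \<subseteq> {..<m} \<and> card S = k. u (card S) (subpt S x) * ?w x) \<in> borel_measurable (unit.P m)"
            by (intro borel_measurable_sum borel_measurable_integrable intw int_u) auto
          show "AE x in unit.P m. h x * ?w x = (\<Sum>k\<in>?K. \<Sum>S | S \<subseteq> {..<m} \<and> card S = k. u (card S) (subpt S x) * ?w x)"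
            using hu by eventually_elim (simp only: sum_distrib_right)
        qed
        also have "\<dots> = (\<Sum>k\<in>?K. LINT x|unit.P m. (\<Sum>S | S \<subseteq> {..<m} \<and> card S = k. u (card S) (subpt S x) * ?w x))"
          by (intro Bochner_Integration.integral_sum Bochner_Integration.integrable_sum intw int_u) auto
        also have "\<dots> = (\<Sum>k\<in>?K. \<Sum>S | S \<subseteq> {..<m} \<and> card S = k. LINT x|unit.P m. u (card S) (subpt S x) * ?w x)"
          by (intro sum.cong[OF refl] Bochner_Integration.integral_sum intw int_u) auto
        also have "\<dots> = 0"
        proof (intro sum.neutral ballI)
          fix l S assume l: "l \<in> ?K" and S: "S \<in> {S. S \<subseteq> {..<m} \<and> card S = l}"
          then have c: "card S \<in> ?K" and Sm: "S \<subseteq> {..<m}" by auto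
          \<comment> \<open>The size of \<open>S\<close> is in \<open>?K\<close> and
            \<open>k\<close> is not, so every component is orthogonal to this weight.\<close>
          have "S \<noteq> {..<k}" using c k(2) by auto
          then show "(LINT x|unit.P m. u (card S) (subpt S x) * ?w x) = 0"
            by (intro unit.integral_component_orthogonal[OF u(1)[OF c] um[OF c] Sm kU]) (auto simp: \<phi>)
        qed
        finally show ?thesis .
      qed
      show ?zero
      proof (intro ballI impI)
        fix A :: "real set" assume A: "A \<in> sets unit_measure" "measure lebesgue A = \<alpha>"
        \<comment> \<open>With this centring, \<alpha> plus \<open>\<phi>\<close> is the indicator
          of \<open>A\<close>, and in each term of the expansion either the coefficient or the
          moment is zero.\<close>
        define \<phi> where "\<phi> t = indicator A t - \<alpha>" for t
        have "integrable unit_measure (indicat_real A)"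
          using A by (intro unit.integrable_bounded_measurable) auto
        moreover have "A \<inter> {0..1} = A" using sets.sets_into_space[OF A(1)] by auto
        ultimately have \<phi>: "unit.bounded_measurable \<phi>" "(LINT t|unit_measure. \<phi> t) = 0"
          using A meas[OF A(1)] unit.prob_space unfolding \<phi>_def by auto
        have \<alpha>\<phi>: "\<alpha> + \<phi> t = indicator A t" for t by (simp add: \<phi>_def)
        have "(LINT x : block m r A | cube m. f x)
          = (\<Sum>k\<le>m. complex_of_real (\<alpha> ^ (m - r) * (1 - \<alpha>) ^ r / \<alpha> ^ k * block_coeff m r \<alpha> k) * unit.power_moment m h k \<phi>)"
          unfolding block[OF A(1)]
          using unit.block_integral_expansion[OF h \<phi>(1) assms(1,2,4)] unfolding \<alpha>\<phi> .
        also have "\<dots> = 0"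
        proof (intro sum.neutral ballI)
          fix k assume "k \<in> {..m}"
          then show "complex_of_real (\<alpha> ^ (m - r) * (1 - \<alpha>) ^ r / \<alpha> ^ k * block_coeff m r \<alpha> k) * unit.power_moment m h k \<phi> = 0"
            using moment[OF _ _ \<phi>, of k] by (cases "k \<in> ?K") (auto simp: Kset_iff)
        qed
        finally show "(LINT x : block m r A | cube m. f x) = 0" .
      qed
    qed
  qed
qed

end
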